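(* Let $m\in\mathbb Z$. For all $N\ge1$, $$\int_{L_1\cup L_2\cup L_3\cup L_5\cup L_6\cup L_7}\frac{e^{z/N}}{2\pi i\,(e^{z/N}-1)^{m+1}(e^{z/N})_N}\,dz=O\big(N^{m+1}e^{0.05N}\big),$$ with implied constant depending only on $m$.
   Context: $(q)_N:=(1-q)(1-q^2)\cdots(1-q^N)$. $z_0\approx-1.6055276+7.4234262i$ is $2\pi i+\log(1-w_0)$ where $w_0\approx0.91619782-0.18245890i$ solves $\mathrm{Li}_2(w)=2\pi i\log w$. Let $c:=\mathrm{Re}(z_0)/\mathrm{Im}(z_0)+i$. The oriented line segments are: $L_1$ from $2\pi$ to $2\pi+8\pi i/5$; $L_2$ from $2\pi+8\pi i/5$ to $-\pi/10+8\pi i/5$; $L_3$ from $-\pi/10+8\pi i/5$ to $2\pi c$; ($L_4$ from $2\pi c$ to $3\pi c$, excluded); $L_5$ from $3\pi c$ to $6\pi c$; $L_6$ from $6\pi c$ to $-20\pi+6\pi i$; $L_7$ from $-20\pi+6\pi i$ to $-20\pi$. *)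

theory Defs
  imports "HOL-Complex_Analysis.Complex_Analysis"
begin

definition qpoch :: "complex \<Rightarrow> nat \<Rightarrow> complex" where
  "qpoch q N = (\<Prod>k = 1..N. 1 - q ^ k)"

text \<open>Dilogarithm via its power series Li_2(w) = sum_{k>=1} w^k/k^2 (valid for |w| < 1,
  which is where the relevant root w_0 lies, |w_0| ~ 0.934).\<close>
definition dilog :: "complex \<Rightarrow> complex" where
  "dilog w = (\<Sum>k. w ^ (Suc k) / (of_nat (Suc k))\<^sup>2)"

definition w0 :: complex where
  "w0 = (THE w. w \<in> ball (Complex 0.91619782 (-0.18245890)) (1/10^6) \<and>
                dilog w = 2 * pi * \<i> * Ln w)"

definition z0 :: complex where
  "z0 = 2 * pi * \<i> + Ln (1 - w0)"

definition cc :: complex where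
  "cc = of_real (Re z0 / Im z0) + \<i>"

definition integrand :: "int \<Rightarrow> nat \<Rightarrow> complex \<Rightarrow> complex" where
  "integrand m N z = exp (z / of_nat N) /
     (2 * pi * \<i> * (exp (z / of_nat N) - 1) powi (m + 1) * qpoch (exp (z / of_nat N)) N)"

definition path_integral :: "int \<Rightarrow> nat \<Rightarrow> complex" where
  "path_integral m N =
     contour_integral (linepath (2*pi) (2*pi + 8*pi*\<i>/5)) (integrand m N)
   + contour_integral (linepath (2*pi + 8*pi*\<i>/5) (-pi/10 + 8*pi*\<i>/5)) (integrand m N)
   + contour_integral (linepath (-pi/10 + 8*pi*\<i>/5) (2*pi*cc)) (integrand m N)
   + contour_integral (linepath (3*pi*cc) (6*pi*cc)) (integrand m N)
   + contour_integral (linepath (6*pi*cc) (-20*pi + 6*pi*\<i>)) (integrand m N)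
   + contour_integral (linepath (-20*pi + 6*pi*\<i>) (-20*pi)) (integrand m N)"

end

theory Submission
  imports Defs "HOL-Real_Asymp.Real_Asymp"
begin

text \<open>
  For \<open>q = exp (z / N)\<close> the logarithm of \<open>|(q)\<^sub>N|\<close> is a Riemann sum of \<open>ln |1 - exp (t z)|\<close> over
  \<open>[0, 1]\<close>. Splitting off \<open>ln t\<close>, whose sum is \<open>ln (N! / N ^ N) \<ge> - N\<close>, leaves a function that is
  Lipschitz uniformly in \<open>z\<close>, so the Riemann sum is \<open>N\<close> times the integral up to a bounded error.
  For \<open>Re z < 0\<close> the integral is \<open>Re ((\<pi>\<^sup>2 / 6 - Li\<^sub>2 (exp z)) / z)\<close>, and it remains to bound this from below
  by \<open>- 0.05\<close> on the last four segments. The first two segments are handled by elementary lower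
  bounds for \<open>|1 - exp (t z)|\<close>.

  The segments depend on \<open>c\<close>, hence on \<open>w\<^sub>0\<close>. That \<open>w\<^sub>0\<close> is well defined follows from the Banach
  fixed point theorem for a simplified Newton map; the value of the equation at the approximate
  root is computed from the reflection formula of the dilogarithm, which replaces \<open>|w| \<approx> 0.93\<close>
  by \<open>|1 - w| \<approx> 0.2\<close>.
\<close>

section \<open>The dilogarithm\<close>

lemma norm_suminf_tail_geometric:
  fixes a :: "nat \<Rightarrow> 'a::banach"
  assumes r: "0 \<le> r" "r < 1" and a: "\<And>k. n \<le> k \<Longrightarrow> norm (a k) \<le> M * r ^ k"
  shows "norm (suminf a - (\<Sum>k<n. a k)) \<le> M * r ^ n / (1 - r)"
proof -
  have g: "(\<lambda>k. M * r ^ n * r ^ k) sums (M * r ^ n * (1 / (1 - r)))"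
    using r by (intro sums_mult geometric_sums) auto
  have le: "norm (a (k + n)) \<le> M * r ^ n * r ^ k" for k
    using a[of "k + n"] by (simp add: power_add mult_ac)
  have sn: "summable (\<lambda>k. norm (a (k + n)))"
    by (rule summable_comparison_test'[OF sums_summable[OF g], of 0]) (use le in auto)
  have "summable a"
    using summable_norm_cancel[OF sn] by (simp only: summable_iff_shift)
  then have "suminf a - (\<Sum>k<n. a k) = (\<Sum>k. a (k + n))"
    by (simp add: suminf_minus_initial_segment)
  also have "norm \<dots> \<le> (\<Sum>k. norm (a (k + n)))"
    by (rule summable_norm[OF sn])
  also have "\<dots> \<le> (\<Sum>k. M * r ^ n * r ^ k)"
    by (rule suminf_le[OF le sn sums_summable[OF g]])
  also have "\<dots> = M * r ^ n / (1 - r)"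
    using sums_unique[OF g] by simp
  finally show ?thesis .
qed

lemma inverse_real_squares_sums: "(\<lambda>k. 1 / (real (k + 1))\<^sup>2) sums (pi\<^sup>2 / 6)"
  using inverse_squares_sums by (simp only: of_nat_power)

lemma norm_dilog_term_le:
  assumes "norm w \<le> 1"
  shows "norm (w ^ Suc k / (of_nat (Suc k))\<^sup>2 :: complex) \<le> 1 / (real (k + 1))\<^sup>2"
proof -
  have "norm (w ^ Suc k / (of_nat (Suc k))\<^sup>2 :: complex) = norm w ^ Suc k / (real (k + 1))\<^sup>2"
    by (simp only: norm_divide norm_power norm_of_nat) simp
  also have "\<dots> \<le> 1 / (real (k + 1))\<^sup>2"
    by (rule divide_right_mono) (use assms in \<open>auto intro: power_le_one simp del: power_Suc\<close>)
  finally show ?thesis .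
qed

lemma dilog_sums:
  assumes "norm w \<le> 1"
  shows "(\<lambda>k. w ^ Suc k / (of_nat (Suc k))\<^sup>2) sums dilog w"
  unfolding dilog_def
proof (rule summable_sums, rule summable_comparison_test')
  show "summable (\<lambda>k. 1 / (real (k + 1))\<^sup>2)"
    using inverse_real_squares_sums by (rule sums_summable)
qed (use norm_dilog_term_le[OF assms] in auto)

text \<open>The terms are dominated by \<open>1 / k\<^sup>2\<close> on the closed disc, so
  convergence is uniform there. The boundary matters: both the reflection formula and the Riemann
  sums reach the point 1.\<close>

lemma continuous_on_dilog: "continuous_on (cball 0 1) dilog"
proof -
  have "uniform_limit (cball 0 1) (\<lambda>n w. \<Sum>k<n. w ^ Suc k / (of_nat (Suc k))\<^sup>2)
          (\<lambda>w. \<Sum>k. w ^ Suc k / (of_nat (Suc k))\<^sup>2 :: complex) sequentially"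
  proof (rule Weierstrass_m_test)
    show "summable (\<lambda>k. 1 / (real (k + 1))\<^sup>2)"
      using inverse_real_squares_sums by (rule sums_summable)
  qed (use norm_dilog_term_le in auto)
  then have "uniform_limit (cball 0 1) (\<lambda>n w. \<Sum>k<n. w ^ Suc k / (of_nat (Suc k))\<^sup>2)
          dilog sequentially"
    by (simp add: dilog_def[abs_def])
  then show ?thesis
    by (rule uniform_limit_theorem[rotated]) (auto intro!: always_eventually continuous_intros simp del: of_nat_Suc)
qed

lemma dilog_0 [simp]: "dilog 0 = 0"
  by (simp add: dilog_def)

lemma dilog_1: "dilog 1 = of_real (pi\<^sup>2 / 6)"
proof -
  have "(\<lambda>n. complex_of_real (1 / (real (n + 1))\<^sup>2)) sums of_real (pi\<^sup>2 / 6)"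
    by (intro sums_of_real) (rule inverse_real_squares_sums)
  moreover have "(\<lambda>n. complex_of_real (1 / (real (n + 1))\<^sup>2)) =
      (\<lambda>k. 1 ^ Suc k / (of_nat (Suc k))\<^sup>2)"
    by (simp add: fun_eq_iff)
  ultimately show ?thesis
    using dilog_sums[of 1] sums_unique2 by force
qed

lemma Ln_one_minus_sums:
  assumes "norm w < 1"
  shows "(\<lambda>k. - (w ^ Suc k / of_nat (Suc k))) sums Ln (1 - w)"
proof -
  have "(\<lambda>n. - (w ^ n / of_nat n)) sums Ln (1 - w)"
    using Ln_series'[of "- w"] assms by simp
  \<comment> \<open>The term at index 0 vanishes because \<open>1 / 0 = 0\<close>, so the shift to
    \<open>Suc k\<close> loses nothing.\<close>
  then show ?thesis
    by (subst sums_Suc_iff) simp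
qed

text \<open>Termwise differentiation turns \<open>w ^ k / k\<^sup>2\<close> into
  \<open>w ^ (k - 1) / k\<close>, the series of the logarithm divided by \<open>w\<close>.\<close>

lemma dilog_has_field_derivative:
  assumes "norm w < 1" "w \<noteq> 0"
  shows "(dilog has_field_derivative - Ln (1 - w) / w) (at w)"
proof -
  \<comment> \<open>Again \<open>c 0 = 0\<close> by division by zero, so indexing from 0 leaves the
    sum unchanged.\<close>
  define c :: "nat \<Rightarrow> complex" where "c n = 1 / (of_nat n)\<^sup>2" for n
  have s: "(\<lambda>n. c n * z ^ n) sums dilog z" if "norm z \<le> 1" for z
  proof -
    have "(\<lambda>n. c (Suc n) * z ^ Suc n) sums dilog z"
      using dilog_sums[OF that] by (simp add: c_def)
    then show ?thesis
      by (subst (asm) sums_Suc_iff) (simp add: c_def)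
  qed
  have "((\<lambda>z. \<Sum>n. c n * z^n) has_field_derivative (\<Sum>n. diffs c n * w^n)) (at w)"
    by (rule termdiffs_strong'[of 1]) (use s assms in \<open>auto simp: sums_iff\<close>)
  moreover have "(\<Sum>n. diffs c n * w^n) = - Ln (1 - w) / w"
  proof -
    have "(\<lambda>k. - (w ^ Suc k / of_nat (Suc k)) * (- 1 / w)) sums (Ln (1 - w) * (- 1 / w))"
      by (intro sums_mult2 Ln_one_minus_sums assms)
    moreover have "- (w ^ Suc k / of_nat (Suc k)) * (- 1 / w) = diffs c k * w ^ k" for k
    proof -
      have "(of_nat (Suc k) :: complex) \<noteq> 0"
        by (rule of_nat_neq_0)
      then show ?thesis
        using assms(2)
        by (simp only: diffs_def c_def) (simp add: field_simps power2_eq_square del: of_nat_Suc)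
    qed
    ultimately show ?thesis
      by (simp add: sums_iff)
  qed
  ultimately have "((\<lambda>z. \<Sum>n. c n * z^n) has_field_derivative - Ln (1 - w) / w) (at w)"
    by simp
  then show ?thesis
    by (rule has_field_derivative_transform_within_open[where S = "ball 0 1"])
      (use s assms in \<open>auto simp: sums_iff\<close>)
qed

text \<open>All later denominators are at least \<open>(n + 1)\<^sup>2\<close>; what remains of the
  tail is geometric.\<close>

lemma dilog_approx:
  assumes "norm w < 1"
  shows "norm (dilog w - (\<Sum>k<n. w ^ Suc k / (of_nat (Suc k))\<^sup>2))
    \<le> norm w ^ Suc n / (real (Suc n))\<^sup>2 / (1 - norm w)"
proof -
  have "norm (dilog w - (\<Sum>k<n. w ^ Suc k / (of_nat (Suc k))\<^sup>2))
      \<le> (norm w / (real (Suc n))\<^sup>2) * norm w ^ n / (1 - norm w)"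
    unfolding dilog_def
  proof (rule norm_suminf_tail_geometric)
    fix k assume k: "n \<le> k"
    have "norm (w ^ Suc k / (of_nat (Suc k))\<^sup>2) = norm w ^ Suc k / (real (Suc k))\<^sup>2"
      by (simp only: norm_divide norm_power norm_of_nat)
    also have "\<dots> \<le> norm w ^ Suc k / (real (Suc n))\<^sup>2"
      using k by (intro divide_left_mono power_mono mult_pos_pos) auto
    finally show "norm (w ^ Suc k / (of_nat (Suc k))\<^sup>2) \<le> norm w / (real (Suc n))\<^sup>2 * norm w ^ k"
      by simp
  qed (use assms in auto)
  then show ?thesis by simp
qed

text \<open>In polar form this is \<open>|sin (n \<theta>)| \<le> n |sin \<theta>|\<close>. It
  bounds every term of the series for \<open>Im (dilog w)\<close> by a multiple of
  \<open>Im w\<close>.\<close>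

lemma abs_Im_power_le: "\<bar>Im (w ^ Suc k)\<bar> \<le> real (Suc k) * norm w ^ k * \<bar>Im w\<bar>"
proof (induction k)
  case 0
  then show ?case by simp
next
  case (Suc k)
  have "\<bar>Im (w ^ Suc (Suc k))\<bar> = \<bar>Re w * Im (w ^ Suc k) + Im w * Re (w ^ Suc k)\<bar>"
    by simp
  also have "\<dots> \<le> norm w * (real (Suc k) * norm w ^ k * \<bar>Im w\<bar>) + \<bar>Im w\<bar> * norm w ^ Suc k"
    by (rule order_trans[OF abs_triangle_ineq], unfold abs_mult,
        intro add_mono mult_mono Suc.IH abs_Re_le_cmod
          order_trans[OF abs_Re_le_cmod eq_refl[OF norm_power]]) auto
  also have "\<dots> = real (Suc (Suc k)) * norm w ^ Suc k * \<bar>Im w\<bar>"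
    by (simp add: algebra_simps)
  finally show ?case .
qed

text \<open>The leading term \<open>Im w\<close> outweighs the rest: \<open>abs_Im_power_le\<close>
  bounds the tail by \<open>- Im w * (- ln (1 - r) / r - 1)\<close>, and
  \<open>- ln (1 - r) / r \<le> 2\<close> for \<open>r \<le> 3/4\<close>.\<close>

lemma Im_dilog_le_0:
  assumes "norm w \<le> 3/4" "Im w \<le> 0"
  shows "Im (dilog w) \<le> 0"
proof (cases "w = 0")
  case False
  define r where "r = norm w"
  have r: "0 < r" "r \<le> 3/4" "r < 1"
    using assms False by (auto simp: r_def)
  let ?t = "\<lambda>k. w ^ Suc k / (of_nat (Suc k))\<^sup>2"
  let ?u = "\<lambda>k. - Im w * (r ^ k / real (Suc k))"
  have L: "(\<lambda>k. r ^ k / real (Suc k)) sums (- ln (1 - r) / r)"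
  proof -
    have "(\<lambda>k. - (complex_of_real r ^ Suc k / of_nat (Suc k))) sums Ln (1 - of_real r)"
      using r by (intro Ln_one_minus_sums) auto
    moreover have "Ln (1 - of_real r) = of_real (ln (1 - r))"
      using r Ln_of_real[of "1 - r"] by simp
    ultimately have "(\<lambda>k. complex_of_real (- (r ^ Suc k / real (Suc k)))) sums of_real (ln (1 - r))"
      by simp
    then have "(\<lambda>k. - (r ^ Suc k / real (Suc k))) sums ln (1 - r)"
      by (simp only: sums_of_real_iff)
    then have "(\<lambda>k. - (r ^ Suc k / real (Suc k)) * (- 1 / r)) sums (ln (1 - r) * (- 1 / r))"
      by (rule sums_mult2)
    moreover have "- (r ^ Suc k / real (Suc k)) * (- 1 / r) = r ^ k / real (Suc k)" for k
      using r by (simp add: field_simps)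
    ultimately show ?thesis by simp
  qed
  \<comment> \<open>On \<open>{1/4..1}\<close> the concave \<open>ln\<close> lies above its chord,
    and at \<open>1/4\<close> it is at least \<open>- 3/2\<close>, the value of
    \<open>- 2 * r\<close> for \<open>r = 3/4\<close>.\<close>
  have "ln (1 - r) \<ge> - 2 * r"
  proof -
    have "ln (4::real) \<le> 3/2"
      using ln_approx_bounds[of 2 3] ln_mult[of 2 "2::real"] by (simp add: eval_nat_numeral)
    moreover have "ln (1/4::real) = - ln 4"
      by (simp add: ln_div)
    ultimately have q: "ln (1/4::real) \<ge> - 3/2" by simp
    have "concave_on {0<..} (ln :: real \<Rightarrow> real)"
      by (rule ln_concave)
    then have "ln ((1 - 4*r/3) *\<^sub>R 1 + (4*r/3) *\<^sub>R (1/4)) \<ge> (1 - 4*r/3) * ln 1 + (4*r/3) * ln (1/4::real)"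
      by (rule concave_onD) (use r in auto)
    moreover have "(1 - 4*r/3) *\<^sub>R 1 + (4*r/3) *\<^sub>R (1/4) = 1 - r" by simp
    moreover have "(4*r/3) * ln (1/4::real) \<ge> (4*r/3) * (- 3/2)"
      by (rule mult_left_mono[OF q]) (use r in auto)
    ultimately show ?thesis by simp
  qed
  then have L2: "- ln (1 - r) / r \<le> 2"
    using r by (simp add: field_simps)
  have "(\<lambda>k. Im (?t k)) sums Im (dilog w)"
    by (rule sums_Im, rule dilog_sums) (use r in \<open>simp add: r_def\<close>)
  then have "(\<lambda>k. Im (?t (Suc k))) sums (Im (dilog w) - Im w)"
    by (subst sums_Suc_iff) simp
  moreover have "(\<lambda>k. ?u k) sums (- Im w * (- ln (1 - r) / r))"
    by (intro sums_mult L)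
  then have "(\<lambda>k. ?u (Suc k)) sums (- Im w * (- ln (1 - r) / r) + Im w)"
    by (subst sums_Suc_iff) simp
  moreover have "Im (?t k) \<le> ?u k" for k
  proof -
    have e: "Im (?t k) = Im (w ^ Suc k) / (real (Suc k))\<^sup>2"
      by (simp only: Im_divide_of_nat flip: of_nat_power)
    have "Im (w ^ Suc k) \<le> real (Suc k) * r ^ k * (- Im w)"
      using order_trans[OF abs_ge_self abs_Im_power_le[of w k]] assms by (simp only: r_def abs_of_nonpos)
    then have "Im (?t k) \<le> real (Suc k) * r ^ k * (- Im w) / (real (Suc k))\<^sup>2"
      unfolding e by (rule divide_right_mono) simp
    also have "\<dots> = ?u k"
      by (simp add: power2_eq_square del: of_nat_Suc)
    finally show ?thesis .
  qed
  ultimately have "Im (dilog w) - Im w \<le> - Im w * (- ln (1 - r) / r) + Im w"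
    by (meson sums_le)
  moreover have "- Im w * (- ln (1 - r) / r) \<le> - Im w * 2"
    by (rule mult_left_mono[OF L2]) (use assms in auto)
  ultimately show ?thesis by linarith
qed simp

text \<open>The function \<open>h\<close> has derivative 0 on the intersection of the unit discs
  around 0 and 1, hence is constant. Its limit at 0 along the positive reals identifies the constant
  as \<open>dilog 1\<close>.\<close>

lemma dilog_reflection:
  assumes "norm w < 1" "norm (1 - w) < 1"
  shows "dilog w + dilog (1 - w) = of_real (pi\<^sup>2 / 6) - Ln w * Ln (1 - w)"
proof -
  define U where "U = ball 0 1 \<inter> ball (1::complex) 1"
  have norm_1: "norm (1 - complex_of_real x) = \<bar>1 - x\<bar>" for x
    by (metis norm_of_real of_real_1 of_real_diff)
  define h where "h w = dilog w + dilog (1 - w) + Ln w * Ln (1 - w)" for w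
  have U: "norm z < 1" "norm (1 - z) < 1" "z \<noteq> 0" "z \<noteq> 1" "z \<notin> \<real>\<^sub>\<le>\<^sub>0" "1 - z \<notin> \<real>\<^sub>\<le>\<^sub>0" if "z \<in> U" for z
  proof -
    show *: "norm z < 1" "norm (1 - z) < 1"
      using that by (auto simp: U_def dist_norm norm_minus_commute)
    then show "z \<noteq> 0" "z \<noteq> 1" by auto
    have "Re z > 0" using *(2) abs_Re_le_cmod[of "1 - z"] by simp
    moreover have "Re (1 - z) > 0" using *(1) abs_Re_le_cmod[of "z"] by simp
    ultimately show "z \<notin> \<real>\<^sub>\<le>\<^sub>0" "1 - z \<notin> \<real>\<^sub>\<le>\<^sub>0"
      by (auto simp: complex_nonpos_Reals_iff)
  qed
  have "(h has_field_derivative 0) (at z within U)" if "z \<in> U" for z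
  proof -
    note Uz = U[OF that]
    have "((\<lambda>w. dilog (1 - w)) has_field_derivative (- Ln (1 - (1 - z)) / (1 - z)) * (0 - 1)) (at z)"
      by (rule DERIV_chain2[OF dilog_has_field_derivative])
        (use Uz in \<open>auto intro!: derivative_eq_intros\<close>)
    then have "(h has_field_derivative 0) (at z)"
      unfolding h_def [abs_def] using Uz
      by (auto intro!: derivative_eq_intros dilog_has_field_derivative simp: divide_simps)
    then show ?thesis
      by (rule DERIV_subset) auto
  qed
  then obtain C where C: "\<And>z. z \<in> U \<Longrightarrow> h z = C"
    using has_field_derivative_zero_constant[of U h] convex_Int[OF convex_ball convex_ball]
    unfolding U_def by blast
  have "((\<lambda>x::real. h (of_real x)) \<longlongrightarrow> C) (at_right 0)"
  proof (rule Lim_transform_eventually[OF tendsto_const])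
    show "\<forall>\<^sub>F x in at_right (0::real). C = h (of_real x)"
      using eventually_at_right_real[of 0 "1::real"]
      by (auto elim!: eventually_mono simp: C U_def dist_norm norm_1)
  qed
  moreover have "((\<lambda>x::real. h (of_real x)) \<longlongrightarrow> 0 + dilog 1 + of_real 0) (at_right 0)"
  proof -
    have cont: "((\<lambda>x::real. dilog (f x)) \<longlongrightarrow> dilog (f 0)) (at_right 0)"
      if "continuous_on {0..1} f" "f ` {0..1} \<subseteq> cball 0 1" for f :: "real \<Rightarrow> complex"
    proof -
      have "continuous_on {0..1} (\<lambda>x. dilog (f x))"
        by (rule continuous_on_compose2[OF continuous_on_dilog that])
      then have "((\<lambda>x. dilog (f x)) \<longlongrightarrow> dilog (f 0)) (at 0 within {0..1})"
        by (auto simp: continuous_on)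
      then show ?thesis
        by (simp add: at_within_Icc_at_right)
    qed
    have l: "((\<lambda>x::real. ln x * ln (1 - x)) \<longlongrightarrow> 0) (at_right 0)"
      by real_asymp
    have "((\<lambda>x::real. Ln (of_real x) * Ln (1 - of_real x)) \<longlongrightarrow> of_real 0) (at_right 0)"
    proof (rule Lim_transform_eventually[OF tendsto_of_real[OF l]])
      have "of_real (ln x * ln (1 - x)) = Ln (complex_of_real x) * Ln (1 - of_real x)"
        if "x \<in> {0<..<1}" for x
        using that Ln_of_real[of "1 - x"] by (simp add: Ln_of_real)
      then show "\<forall>\<^sub>F x in at_right 0.
          of_real (ln x * ln (1 - x)) = Ln (complex_of_real x) * Ln (1 - of_real x)"
        using eventually_at_right_real[of 0 "1::real"] by (auto elim!: eventually_mono)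
    qed
    moreover have "((\<lambda>x::real. dilog (of_real x)) \<longlongrightarrow> 0) (at_right 0)"
      using cont[of of_real] by (simp add: image_subset_iff continuous_on_of_real_id)
    moreover have "((\<lambda>x::real. dilog (1 - of_real x)) \<longlongrightarrow> dilog 1) (at_right 0)"
      using cont[of "\<lambda>x. 1 - of_real x"]
      by (simp add: image_subset_iff norm_1 continuous_on_of_real_id continuous_on_diff)
    ultimately show ?thesis
      unfolding h_def by (intro tendsto_add)
  qed
  ultimately have "C = dilog 1"
    using tendsto_unique[of "at_right (0::real)"] by fastforce
  moreover have "w \<in> U"
    using assms by (auto simp: U_def dist_norm norm_minus_commute)
  ultimately show ?thesis
    using C[of w] by (simp add: h_def dilog_1 eq_diff_eq)
qed

section \<open>Lower bounds for the product\<close>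

lemma sum_exp_series_le: "finite A \<Longrightarrow> 0 \<le> x \<Longrightarrow> (\<Sum>k\<in>A. x ^ k / fact k) \<le> exp (x::real)"
  using sum_le_suminf[OF summable_exp_generic[of x], of A]
  by (simp add: exp_def divide_inverse mult.commute)

text \<open>A single term of the exponential series, \<open>N ^ N / N! \<le> exp N\<close>, takes
  the place of Stirling's formula.\<close>

lemma exp_minus_le_prod_fractions: "exp (- real N) \<le> (\<Prod>k = 1..N. real k / real N)" if "N \<ge> 1"
proof -
  have "(\<Prod>k = 1..N. real k / real N) = fact N / real N ^ N"
    by (simp add: prod_dividef fact_prod)
  moreover have "real N ^ N \<le> fact N * exp (real N)"
    using sum_exp_series_le[of "{N}" "real N"] by (simp add: field_simps)
  then have "exp (- real N) \<le> fact N / real N ^ N"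
    using that by (simp add: exp_minus divide_simps mult.commute)
  ultimately show ?thesis
    by (simp only:)
qed

text \<open>By the mean value theorem the value of \<open>g\<close> at a right endpoint differs from
  its mean over the subinterval by at most \<open>G / N\<close>, and \<open>N\<close> such errors
  add up to \<open>G\<close>. At the ends \<open>P\<close> is merely continuous, since it will
  contain \<open>t * ln t\<close>.\<close>

lemma riemann_sum_ge:
  fixes P g :: "real \<Rightarrow> real"
  assumes cont: "continuous_on {0..1} P"
    and deriv: "\<And>t. 0 < t \<Longrightarrow> t < 1 \<Longrightarrow> (P has_real_derivative g t) (at t)"
    and lip: "\<And>s t. 0 < s \<Longrightarrow> s \<le> t \<Longrightarrow> t \<le> 1 \<Longrightarrow> \<bar>g t - g s\<bar> \<le> G * (t - s)"
    and N: "N \<ge> 1" and G: "G \<ge> 0"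
  shows "(\<Sum>k = 1..N. g (real k / real N)) \<ge> real N * (P 1 - P 0) - G"
proof -
  have step: "g (real k / real N) \<ge> real N * (P (real k / real N) - P (real (k - 1) / real N)) - G / real N"
    if k: "k \<in> {1..N}" for k
  proof -
    let ?a = "real (k - 1) / real N" and ?b = "real k / real N"
    have ab: "0 \<le> ?a" "?a < ?b" "?b \<le> 1" "?b - ?a = 1 / real N"
      using k N by (auto simp: field_simps of_nat_diff)
    obtain x where x: "?a < x" "x < ?b" "P ?b - P ?a = g x * (?b - ?a)"
    proof (rule mvt[OF ab(2)])
      show "continuous_on {?a..?b} P"
        by (rule continuous_on_subset[OF cont]) (use ab in auto)
      show "(P has_derivative (\<lambda>h. g x * h)) (at x)" if "?a < x" "x < ?b" for x
        using deriv[of x] that ab unfolding has_field_derivative_def by auto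
    qed
    have "\<bar>g ?b - g x\<bar> \<le> G * (?b - x)"
      by (rule lip) (use x ab in linarith)+
    also have "\<dots> \<le> G * (1 / real N)"
      by (rule mult_left_mono) (use x ab G in auto)
    finally have "g ?b \<ge> g x - G / real N" by simp
    moreover have "g x = real N * (P ?b - P ?a)"
      using x ab N by simp
    ultimately show ?thesis by simp
  qed
  have tel: "(\<Sum>k = 1..n. P (real k / real N) - P (real (k - 1) / real N)) = P (real n / real N) - P 0" for n
    by (induction n) auto
  have "real N * (P 1 - P 0) - G =
      (\<Sum>k = 1..N. real N * (P (real k / real N) - P (real (k - 1) / real N)) - G / real N)"
    by (subst sum_subtractf, subst sum_distrib_left[symmetric], subst tel) (use N in simp)
  also have "\<dots> \<le> (\<Sum>k = 1..N. g (real k / real N))"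
    by (rule sum_mono) (rule step)
  finally show ?thesis .
qed

text \<open>Dividing out the zero at 0 splits \<open>1 - exp (t z)\<close> into the factor
  \<open>t\<close>, which is left to factorials, and a smooth factor whose logarithm is Lipschitz in
  \<open>t\<close>.\<close>

definition expm1_quot :: "complex \<Rightarrow> complex" where
  "expm1_quot w = (if w = 0 then 1 else (exp w - 1) / w)"

lemma holomorphic_expm1_quot: "expm1_quot holomorphic_on UNIV"
proof (rule pole_theorem_0[where g = "\<lambda>w. exp w - 1" and a = 0])
  show "expm1_quot 0 = deriv (\<lambda>w. exp w - 1) 0"
    by (rule DERIV_imp_deriv[symmetric]) (auto intro!: derivative_eq_intros simp: expm1_quot_def)
qed (auto simp: expm1_quot_def intro!: holomorphic_intros)

lemma exp_minus_1_eq: "exp w - 1 = w * expm1_quot w"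
  by (simp add: expm1_quot_def)

text \<open>The zeros are the nonzero multiples of \<open>2 \<pi> \<i>\<close>. With
  \<open>t \<le> 1\<close> the point \<open>t z\<close> reaches one only if \<open>z\<close> is
  purely imaginary of modulus at least \<open>2 \<pi>\<close>.\<close>

lemma expm1_quot_nonzero:
  assumes "Re z \<noteq> 0 \<or> \<bar>Im z\<bar> < 2 * pi" "t \<in> {0..1}"
  shows "expm1_quot (of_real t * z) \<noteq> 0"
proof
  assume "expm1_quot (of_real t * z) = 0"
  then have tz: "t \<noteq> 0" "z \<noteq> 0" "exp (of_real t * z) = 1"
    by (auto simp: expm1_quot_def split: if_splits)
  then obtain n :: int where n: "Re z = 0" "t * Im z = of_int (2 * n) * pi"
    unfolding exp_eq_1 by auto
  then have "\<bar>Im z\<bar> < 2 * pi"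
    using assms by simp
  have "n \<noteq> 0"
    using n tz by (auto simp: complex_eq_iff)
  then have "2 * pi \<le> \<bar>of_int (2 * n) * pi\<bar>"
    by (simp add: abs_mult)
  also have "\<dots> = t * \<bar>Im z\<bar>"
    using assms(2) by (simp add: abs_mult del: of_int_mult flip: n(2))
  also have "\<dots> \<le> 1 * \<bar>Im z\<bar>"
    by (rule mult_right_mono) (use assms(2) in auto)
  finally show False
    using \<open>\<bar>Im z\<bar> < 2 * pi\<close> by simp
qed

lemma norm_qpoch_exp:
  "norm (qpoch (exp (z / of_nat N)) N) = (\<Prod>k = 1..N. norm (1 - exp (of_real (real k / real N) * z)))"
proof -
  have "exp (z / of_nat N) ^ k = exp (of_real (real k / real N) * z)" for k
    by (simp flip: exp_of_nat_mult)
  then show ?thesis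
    by (simp add: qpoch_def prod_norm)
qed

text \<open>The points \<open>t z\<close> fill the compact set \<open>H\<close>, on which the entire
  function and its derivative are bounded. Having no zero in \<open>H\<close>, the function also has
  a bounded reciprocal, which gives \<open>b\<close>.\<close>

lemma expm1_quot_bounds:
  assumes S: "compact S" "\<And>z. z \<in> S \<Longrightarrow> Re z \<noteq> 0 \<or> \<bar>Im z\<bar> < 2 * pi"
  obtains b B D where "b > 0" "B > 0" "D > 0"
    "\<And>z t. z \<in> S \<Longrightarrow> t \<in> {0..1} \<Longrightarrow> b \<le> norm (expm1_quot (of_real t * z))"
    "\<And>z t. z \<in> S \<Longrightarrow> t \<in> {0..1} \<Longrightarrow> norm (expm1_quot (of_real t * z)) \<le> B"
    "\<And>z t. z \<in> S \<Longrightarrow> t \<in> {0..1} \<Longrightarrow> norm (deriv expm1_quot (of_real t * z)) \<le> D"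
proof -
  define H where "H = (\<lambda>p. of_real (fst p) * snd p) ` ({0..1::real} \<times> S)"
  have "compact H"
    unfolding H_def using S by (intro compact_continuous_image compact_Times continuous_intros) auto
  have cont: "continuous_on H expm1_quot" "continuous_on H (deriv expm1_quot)"
    using holomorphic_expm1_quot holomorphic_deriv[OF holomorphic_expm1_quot]
    by (auto intro: holomorphic_on_imp_continuous_on holomorphic_on_subset)
  have bd: "\<exists>B>0. \<forall>w\<in>H. norm (f w) \<le> B" if "continuous_on H f" for f :: "complex \<Rightarrow> complex"
    using compact_imp_bounded[OF compact_continuous_image[OF that \<open>compact H\<close>]]
    by (auto simp: bounded_pos)
  have "\<exists>B>0. \<forall>w\<in>H. norm (inverse (expm1_quot w)) \<le> B"
    by (rule bd, rule continuous_on_inverse[OF cont(1)]) (use S expm1_quot_nonzero in \<open>force simp: H_def\<close>)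
  then obtain B0 where B0: "B0 > 0" "\<And>w. w \<in> H \<Longrightarrow> norm (inverse (expm1_quot w)) \<le> B0"
    by blast
  obtain B where B: "B > 0" "\<And>w. w \<in> H \<Longrightarrow> norm (expm1_quot w) \<le> B"
    using bd[OF cont(1)] by blast
  obtain D where D: "D > 0" "\<And>w. w \<in> H \<Longrightarrow> norm (deriv expm1_quot w) \<le> D"
    using bd[OF cont(2)] by blast
  have H: "of_real t * z \<in> H" if "z \<in> S" "t \<in> {0..1}" for z t
    using that unfolding H_def by force
  show ?thesis
  proof (rule that[of "1 / B0" B D])
    fix z t assume *: "z \<in> S" "t \<in> {0..1::real}"
    then have "expm1_quot (of_real t * z) \<noteq> 0"
      using S expm1_quot_nonzero by blast
    then show "1 / B0 \<le> norm (expm1_quot (of_real t * z))"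
      using B0(2)[OF H[OF *]] B0(1) by (simp add: norm_inverse norm_divide divide_simps mult.commute)
  qed (use B D B0 H in auto)
qed

text \<open>For \<open>Re z < 0\<close> and \<open>t > 0\<close> the point \<open>exp (t z)\<close>
  lies in the unit disc, where \<open>- dilog (exp (t z)) / z\<close> is an antiderivative of
  \<open>Ln (1 - exp (t z))\<close>. So the limiting integral is explicit, and compactness makes the
  error \<open>G\<close> uniform in \<open>z\<close> and \<open>N\<close>.\<close>

lemma qpoch_exp_ge:
  assumes S: "compact S" "\<And>z. z \<in> S \<Longrightarrow> Re z \<noteq> 0 \<or> \<bar>Im z\<bar> < 2 * pi"
  obtains G where "\<And>z N. z \<in> S \<Longrightarrow> Re z < 0 \<Longrightarrow> N \<ge> 1 \<Longrightarrow>
    norm (qpoch (exp (z / of_nat N)) N)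
      \<ge> exp (real N * Re ((of_real (pi\<^sup>2 / 6) - dilog (exp z)) / z) - G)"
proof -
  obtain b B D where b: "b > 0" and D: "D > 0"
    and bz: "\<And>z t. z \<in> S \<Longrightarrow> t \<in> {0..1} \<Longrightarrow> b \<le> norm (expm1_quot (of_real t * z))"
    and Dz: "\<And>z t. z \<in> S \<Longrightarrow> t \<in> {0..1} \<Longrightarrow> norm (deriv expm1_quot (of_real t * z)) \<le> D"
    using expm1_quot_bounds[OF S] by metis
  obtain R where R: "R > 0" "\<And>z. z \<in> S \<Longrightarrow> norm z \<le> R"
    using compact_imp_bounded[OF S(1)] by (auto simp: bounded_pos)
  define G where "G = D * R / b"
  show ?thesis
  proof (rule that)
    fix z N assume z: "z \<in> S" "Re z < 0" and N: "N \<ge> (1::nat)"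
    have z0: "z \<noteq> 0" using z by auto
    \<comment> \<open>\<open>g t\<close> is \<open>ln |1 - exp (t z)| - ln t\<close>, extended to
      \<open>t = 0\<close>. \<open>P\<close> is its antiderivative, with \<open>t * ln t - t\<close>
      accounting for \<open>ln t\<close>.\<close>
    define g where "g t = ln (norm (z * expm1_quot (of_real t * z)))" for t :: real
    define P where "P t = Re (- dilog (exp (of_real t * z)) / z) - (t * ln t - t)" for t :: real
    have pos: "norm (expm1_quot (of_real t * z)) > 0" if "t \<in> {0..1}" for t
      using bz[OF z(1) that] b by linarith
    have g: "ln (norm (1 - exp (of_real t * z))) = ln t + g t" if "0 < t" "t \<le> 1" for t
    proof -
      have "norm (1 - exp (of_real t * z)) = norm (of_real t * z * expm1_quot (of_real t * z))"
        by (subst norm_minus_commute) (simp only: exp_minus_1_eq)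
      also have "\<dots> = t * norm (z * expm1_quot (of_real t * z))"
        using that by (simp add: norm_mult)
      finally show ?thesis
        using pos[of t] that z0 by (simp add: g_def ln_mult norm_mult)
    qed
    have lip: "\<bar>g t - g s\<bar> \<le> G * (t - s)" if "0 < s" "s \<le> t" "t \<le> 1" for s t
    proof -
      let ?x = "norm (expm1_quot (of_real t * z))" and ?y = "norm (expm1_quot (of_real s * z))"
      have ln_diff: "ln x - ln y \<le> \<bar>x - y\<bar> / b" if "x \<ge> b" "y \<ge> b" for x y
      proof -
        have "ln x - ln y = ln (x / y)" using that b by (simp add: ln_div)
        also have "\<dots> \<le> x / y - 1" using that b by (intro ln_le_minus_one) auto
        also have "\<dots> = (x - y) / y" using that b by (simp add: field_simps)
        also have "\<dots> \<le> \<bar>x - y\<bar> / y" using that b by (intro divide_right_mono) auto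
        also have "\<dots> \<le> \<bar>x - y\<bar> / b" using that b by (intro divide_left_mono) auto
        finally show ?thesis .
      qed
      have st: "s \<in> {0..1}" "t \<in> {0..1}" using that by auto
      have "g t - g s = ln ?x - ln ?y"
        using z0 pos[OF st(1)] pos[OF st(2)] by (simp add: g_def norm_mult ln_mult)
      then have "\<bar>g t - g s\<bar> \<le> \<bar>?x - ?y\<bar> / b"
        using ln_diff[OF bz[OF z(1) st(2)] bz[OF z(1) st(1)]]
          ln_diff[OF bz[OF z(1) st(1)] bz[OF z(1) st(2)]] by (simp add: abs_minus_commute)
      also have "\<dots> \<le> norm (expm1_quot (of_real t * z) - expm1_quot (of_real s * z)) / b"
        using b by (intro divide_right_mono norm_triangle_ineq3) auto
      also have "\<dots> \<le> D * norm (of_real t * z - of_real s * z) / b"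
      proof (intro divide_right_mono field_differentiable_bound[where f' = "deriv expm1_quot" and S = "closed_segment 0 z"])
        fix u assume u: "u \<in> closed_segment 0 z"
        then obtain v where v: "u = of_real v * z" "v \<in> {0..1}"
          by (auto simp: closed_segment_def scaleR_conv_of_real)
        then show "norm (deriv expm1_quot u) \<le> D" using Dz[OF z(1)] by simp
        show "(expm1_quot has_field_derivative deriv expm1_quot u) (at u within closed_segment 0 z)"
          by (meson holomorphic_derivI[OF holomorphic_expm1_quot open_UNIV UNIV_I])
      qed (use st b in \<open>auto simp: in_segment scaleR_conv_of_real\<close>)
      also have "norm (of_real t * z - of_real s * z) = (t - s) * norm z"
        using that by (simp flip: left_diff_distrib of_real_diff add: norm_mult del: of_real_diff)
      also have "D * ((t - s) * norm z) / b \<le> D * ((t - s) * R) / b"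
        using R(2)[OF z(1)] that D b by (intro divide_right_mono mult_left_mono) auto
      finally show ?thesis by (simp add: G_def mult_ac)
    qed
    have disc: "norm (exp (of_real t * z)) \<le> 1" if "0 \<le> t" for t
      using that z by (simp add: mult_nonneg_nonpos)
    have "continuous_on {0..1} P"
    proof -
      have "continuous_on {0..1} (\<lambda>t. dilog (exp (of_real t * z)))"
        by (rule continuous_on_compose2[OF continuous_on_dilog])
          (use disc in \<open>auto intro!: continuous_intros\<close>)
      then have "continuous_on {0..1} (\<lambda>t. Re (- dilog (exp (of_real t * z)) / z))"
        using z0 by (intro continuous_intros) auto
      moreover have "continuous_on {0..1} (\<lambda>t::real. t * ln t)"
        unfolding continuous_on
      proof
        fix x :: real assume x: "x \<in> {0..1}"
        show "((\<lambda>t. t * ln t) \<longlongrightarrow> x * ln x) (at x within {0..1})"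
        proof (cases "x = 0")
          case True
          have "((\<lambda>t::real. t * ln t) \<longlongrightarrow> 0) (at_right 0)"
            by real_asymp
          then show ?thesis using True by (simp add: at_within_Icc_at_right)
        next
          case False
          then show ?thesis using x by (auto intro!: tendsto_intros)
        qed
      qed
      ultimately show ?thesis
        unfolding P_def by (intro continuous_on_diff continuous_on_id)
    qed
    moreover have "(P has_real_derivative g t) (at t)" if "0 < t" "t < 1" for t
    proof -
      have lt: "norm (exp (of_real t * z)) < 1"
        using that z by (simp add: mult_pos_neg)
      have "((\<lambda>t. - dilog (exp (of_real t * z)) / z) has_vector_derivative
          Ln (1 - exp (of_real t * z))) (at t)"
      proof -
        have "((\<lambda>u. - dilog (exp (u * z)) / z) has_field_derivative
            Ln (1 - exp (of_real t * z))) (at (of_real t))"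
          by (rule derivative_eq_intros refl DERIV_chain2[where f = dilog, OF dilog_has_field_derivative] | use lt z0 in simp)+
        then show ?thesis
          by (rule has_vector_derivative_real_field)
      qed
      then have "((\<lambda>t. Re (- dilog (exp (of_real t * z)) / z)) has_real_derivative
          Re (Ln (1 - exp (of_real t * z)))) (at t)"
        by (rule has_field_derivative_Re)
      moreover have "Re (Ln (1 - exp (of_real t * z))) = ln t + g t"
      proof -
        have "1 - exp (of_real t * z) \<noteq> 0"
          using lt by (metis eq_iff_diff_eq_0 less_irrefl norm_one)
        then show ?thesis
          using g[of t] that by simp
      qed
      moreover have "((\<lambda>t. t * ln t - t) has_real_derivative ln t) (at t)"
        using that by (auto intro!: derivative_eq_intros)
      ultimately show ?thesis
        unfolding P_def[abs_def] using DERIV_diff by fastforce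
    qed
    ultimately have sum_g: "(\<Sum>k = 1..N. g (real k / real N)) \<ge> real N * (P 1 - P 0) - G"
      using lip N R D b by (intro riemann_sum_ge) (auto simp: G_def)
    \<comment> \<open>The summand 1 comes from \<open>t * ln t - t\<close> at \<open>t = 1\<close>;
      it cancels the factor \<open>exp (- real N)\<close> of the factorial bound.\<close>
    have P: "P 1 - P 0 = Re ((of_real (pi\<^sup>2 / 6) - dilog (exp z)) / z) + 1"
      by (simp add: P_def dilog_1 diff_divide_distrib)
    have "exp (real N * Re ((of_real (pi\<^sup>2 / 6) - dilog (exp z)) / z) - G)
        = exp (- real N) * exp (real N * (P 1 - P 0) - G)"
      unfolding P by (simp flip: exp_add add: algebra_simps)
    also have "\<dots> \<le> (\<Prod>k = 1..N. real k / real N) * exp (\<Sum>k = 1..N. g (real k / real N))"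
      using exp_minus_le_prod_fractions[OF N] sum_g by (intro mult_mono) (auto intro: prod_nonneg)
    also have "\<dots> = (\<Prod>k = 1..N. real k / real N * exp (g (real k / real N)))"
      by (simp only: prod.distrib exp_sum finite_atLeastAtMost)
    also have "\<dots> = norm (qpoch (exp (z / of_nat N)) N)"
      unfolding norm_qpoch_exp
    proof (rule prod.cong)
      fix k assume k: "k \<in> {1..N}"
      let ?t = "real k / real N"
      have t: "0 < ?t" "?t \<le> 1" using k N by auto
      have "norm (1 - exp (of_real ?t * z)) > 0"
      proof -
        have "norm (exp (of_real ?t * z)) < 1"
          using mult_pos_neg[OF t(1) z(2)] by simp
        then have "1 - exp (of_real ?t * z) \<noteq> 0"
          by (metis eq_iff_diff_eq_0 less_irrefl norm_one)
        then show ?thesis by simp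
      qed
      then have "norm (1 - exp (of_real ?t * z)) = exp (ln ?t + g ?t)"
        using g[OF t] by (metis exp_ln)
      also have "\<dots> = ?t * exp (g ?t)"
        using t by (simp add: exp_add)
      finally show "?t * exp (g ?t) = norm (1 - exp (of_real ?t * z))" ..
    qed simp
    finally show "norm (qpoch (exp (z / of_nat N)) N)
      \<ge> exp (real N * Re ((of_real (pi\<^sup>2 / 6) - dilog (exp z)) / z) - G)" .
  qed
qed

section \<open>The root of the dilogarithm equation\<close>

definition w_approx :: complex where
  "w_approx = Complex 0.91619782 (-0.18245890)"

definition v_approx :: complex where
  "v_approx = Complex 0.08380218 0.18245890"

lemma one_minus_w_approx: "1 - w_approx = v_approx"
  by (simp add: w_approx_def v_approx_def complex_eq_iff)

lemma norm_Complex_le: "a * a + b * b \<le> c * c \<Longrightarrow> 0 \<le> c \<Longrightarrow> norm (Complex a b) \<le> c"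
  by (rule power2_le_imp_le) (simp_all add: cmod_power2 power2_eq_square[of a] power2_eq_square[of b] power2_eq_square[of c])

lemma norm_Complex_ge: "c * c \<le> a * a + b * b \<Longrightarrow> c \<le> norm (Complex a b)"
  by (rule power2_le_imp_le) (simp_all add: cmod_power2 power2_eq_square[of a] power2_eq_square[of b] power2_eq_square[of c])

lemma abs_diff_leI: "a - e \<le> x \<Longrightarrow> x \<le> a + e \<Longrightarrow> \<bar>x - a\<bar> \<le> (e::real)"
  by simp

lemma Re_Ln_eq_half_ln: "z \<noteq> 0 \<Longrightarrow> Re (Ln z) = ln ((Re z)\<^sup>2 + (Im z)\<^sup>2) / 2"
  by (simp add: ln_realpow flip: cmod_power2)

lemma Ln_w_approx: "\<bar>Re (Ln w_approx) - (-0.06807616)\<bar> \<le> 1/10^8" "\<bar>Im (Ln w_approx) - (-0.19657613)\<bar> \<le> 1/10^8"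
proof -
  have nz: "w_approx \<noteq> 0" by (simp add: w_approx_def complex_eq_iff)
  \<comment> \<open>Passing to the reciprocal makes the argument of \<open>ln\<close> exceed
    1.\<close>
  have eq: "Re (Ln w_approx) = - ln (1 / (0.91619782\<^sup>2 + 0.18245890\<^sup>2)) / 2"
    unfolding Re_Ln_eq_half_ln[OF nz] by (simp add: w_approx_def ln_div)
  show "\<bar>Re (Ln w_approx) - (-0.06807616)\<bar> \<le> 1/10^8"
    unfolding eq by (rule abs_diff_leI) (use ln_approx_bounds[of "1 / (0.91619782\<^sup>2 + 0.18245890\<^sup>2)" 3] in \<open>simp_all add: eval_nat_numeral\<close>)
  have eq: "Im (Ln w_approx) = - arctan (0.18245890 / 0.91619782)"
    using Im_Ln_eq[OF nz] by (simp add: w_approx_def arctan_minus)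
  \<comment> \<open>By the addition theorem the subtracted argument is
    \<open>(1/5 - x) / (1 + x / 5)\<close>, where \<open>x\<close> is the ratio on the left. It is
    tiny, so one comparison with \<open>arctan (1/5)\<close> gives eight decimals.\<close>
  have diff: "arctan (0.18245890 / 0.91619782) = arctan (1/5) - arctan (390332 / 476344800)"
    using arctan_add[of "0.18245890 / 0.91619782" "390332 / 476344800"] by simp
  show "\<bar>Im (Ln w_approx) - (-0.19657613)\<bar> \<le> 1/10^8"
    unfolding eq diff by (rule abs_diff_leI)
      (use arctan_bounds[of "1/5" 3] arctan_bounds[of "390332 / 476344800" 1] in \<open>simp_all add: eval_nat_numeral\<close>)
qed

lemma ln_5_eq: "ln (5::real) = 2 * ln 2 + ln (5/4)"
  using ln_mult[of 4 "5/4"] ln_realpow[of 2 2] by simp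

lemma Ln_v_approx: "\<bar>Re (Ln v_approx) - (-1.6055275)\<bar> \<le> 1/10^6" "\<bar>Im (Ln v_approx) - 1.1402409\<bar> \<le> 1/10^6"
proof -
  have nz: "v_approx \<noteq> 0" by (simp add: v_approx_def complex_eq_iff)
  \<comment> \<open>Multiplying by 25 brings \<open>|v_approx|\<^sup>2\<close> close to 1, where few
    terms of the logarithm suffice.\<close>
  have "ln (0.08380218\<^sup>2 + 0.18245890\<^sup>2 :: real) = ln (25 * (0.08380218\<^sup>2 + 0.18245890\<^sup>2)) - 2 * ln 5"
    using ln_mult[of 25 "0.08380218\<^sup>2 + 0.18245890\<^sup>2"] ln_realpow[of 5 2] by simp
  also note ln_5_eq
  finally have "ln (0.08380218\<^sup>2 + 0.18245890\<^sup>2 :: real) =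
      ln (25 * (0.08380218\<^sup>2 + 0.18245890\<^sup>2)) - 4 * ln 2 - 2 * ln (5/4)" by simp
  moreover have "\<bar>ln (25 * (0.08380218\<^sup>2 + 0.18245890\<^sup>2)) - 0.00782069\<bar> \<le> (1/10^7 :: real)"
    by (rule abs_diff_leI) (use ln_approx_bounds[of "25 * (0.08380218\<^sup>2 + 0.18245890\<^sup>2)" 2] in \<open>simp_all add: eval_nat_numeral\<close>)
  moreover have "\<bar>ln 2 - 0.69314718\<bar> \<le> (1/10^7 :: real)"
    by (rule abs_diff_leI) (use ln_approx_bounds[of 2 7] in \<open>simp_all add: eval_nat_numeral\<close>)
  moreover have "\<bar>ln (5/4) - 0.22314355\<bar> \<le> (1/10^7 :: real)"
    by (rule abs_diff_leI) (use ln_approx_bounds[of "5/4" 4] in \<open>simp_all add: eval_nat_numeral\<close>)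
  moreover have "Re (Ln v_approx) = ln (0.08380218\<^sup>2 + 0.18245890\<^sup>2) / 2"
    unfolding Re_Ln_eq_half_ln[OF nz] by (simp add: v_approx_def)
  ultimately show "\<bar>Re (Ln v_approx) - (-1.6055275)\<bar> \<le> 1/10^6"
    unfolding abs_le_iff by simp
  \<comment> \<open>The angle is closer to \<open>\<pi> / 2\<close> than to 0, so the complementary
    angle is computed, this time by comparison with \<open>arctan (6/13)\<close>.\<close>
  have eq: "Im (Ln v_approx) = pi / 2 - arctan (0.08380218 / 0.18245890)"
    using Im_Ln_eq[OF nz] arctan_inverse[of "0.18245890 / 0.08380218"]
    by (simp add: v_approx_def)
  have diff: "arctan (0.08380218 / 0.18245890) = arctan (6/13) - arctan (532506 / 287477878)"
    using arctan_add[of "0.08380218 / 0.18245890" "532506 / 287477878"] by simp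
  show "\<bar>Im (Ln v_approx) - 1.1402409\<bar> \<le> 1/10^6"
    unfolding eq diff by (rule abs_diff_leI)
      (use arctan_bounds[of "6/13" 4] arctan_bounds[of "532506 / 287477878" 1] pi_approx in \<open>simp_all add: eval_nat_numeral\<close>)
qed

text \<open>Since \<open>|v_approx|\<close> is about 0.2, six terms of the series leave a tail below
  \<open>5 / 10^7\<close>.\<close>

lemma dilog_v_approx: "norm (dilog v_approx - Complex 0.07636763 0.18974971) \<le> 1/10^6"
proof -
  have n: "norm v_approx \<le> 0.201"
    unfolding v_approx_def by (rule norm_Complex_le) simp_all
  let ?s = "\<Sum>k<6. v_approx ^ Suc k / (of_nat (Suc k))\<^sup>2"
  have "norm (dilog v_approx - ?s) \<le> norm v_approx ^ Suc 6 / (real (Suc 6))\<^sup>2 / (1 - norm v_approx)"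
    by (rule dilog_approx) (use n in simp)
  also have "\<dots> \<le> 0.201 ^ Suc 6 / (real (Suc 6))\<^sup>2 / (1 - 0.201)"
    using n by (intro frac_le divide_right_mono power_mono) auto
  also have "\<dots> \<le> 5 / 10^7"
    by (simp add: eval_nat_numeral)
  finally have t: "norm (dilog v_approx - ?s) \<le> 5 / 10^7" .
  have s: "?s = v_approx + v_approx * v_approx / 4 + v_approx * v_approx * v_approx / 9
      + v_approx * v_approx * v_approx * v_approx / 16
      + v_approx * v_approx * v_approx * v_approx * v_approx / 25
      + v_approx * v_approx * v_approx * v_approx * v_approx * v_approx / 36"
    by (simp add: eval_nat_numeral mult.assoc)
  have "\<bar>Re ?s - 0.07636763\<bar> \<le> 1/10^7" "\<bar>Im ?s - 0.18974971\<bar> \<le> 1/10^7"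
    unfolding s by (simp_all add: v_approx_def)
  then have "norm (?s - Complex 0.07636763 0.18974971) \<le> 2/10^7"
    using cmod_le[of "?s - Complex 0.07636763 0.18974971"] by simp
  with t show ?thesis
    using norm_triangle_ineq[of "dilog v_approx - ?s" "?s - Complex 0.07636763 0.18974971"] by simp
qed

section \<open>Newton iteration for the dilogarithm equation\<close>

definition dilog_eqn :: "complex \<Rightarrow> complex" where
  "dilog_eqn w = dilog w - 2 * of_real pi * \<i> * Ln w"

lemma abs_mult_diff_le:
  fixes x y a b e f :: real
  assumes "\<bar>x - a\<bar> \<le> e" "\<bar>y - b\<bar> \<le> f"
  shows "\<bar>x * y - a * b\<bar> \<le> \<bar>a\<bar> * f + \<bar>b\<bar> * e + e * f"
proof -
  have "x * y - a * b = a * (y - b) + b * (x - a) + (x - a) * (y - b)"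
    by (simp add: algebra_simps)
  also have "\<bar>\<dots>\<bar> \<le> \<bar>a * (y - b)\<bar> + \<bar>b * (x - a)\<bar> + \<bar>(x - a) * (y - b)\<bar>"
    by linarith
  also have "\<dots> \<le> \<bar>a\<bar> * f + \<bar>b\<bar> * e + e * f"
    unfolding abs_mult by (intro add_mono mult_mono assms) (use assms in auto)
  finally show ?thesis .
qed

text \<open>After reflection the residual involves only \<open>dilog v_approx\<close>, the two
  logarithms and \<open>\<pi>\<close>, all known to about six decimals;
  \<open>abs_mult_diff_le\<close> propagates the errors through the products.\<close>

lemma norm_dilog_eqn_w_approx: "norm (dilog_eqn w_approx) \<le> 5/10^6"
proof -
  have "norm v_approx \<le> 0.99" "norm w_approx \<le> 0.99"
    unfolding v_approx_def w_approx_def by (rule norm_Complex_le; simp)+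
  then have nv: "norm v_approx < 1" and nw: "norm w_approx < 1"
    by simp_all
  have "dilog w_approx + dilog v_approx = of_real (pi\<^sup>2 / 6) - Ln w_approx * Ln v_approx"
    using dilog_reflection[of w_approx] nv nw by (simp add: one_minus_w_approx)
  then have eq: "dilog_eqn w_approx =
      of_real (pi\<^sup>2 / 6) - dilog v_approx - Ln w_approx * (Ln v_approx + 2 * of_real pi * \<i>)"
    unfolding dilog_eqn_def by (simp add: algebra_simps add_eq_0_iff)
  have pi2: "\<bar>pi\<^sup>2 / 6 - 1.64493407\<bar> \<le> 1/10^7"
  proof -
    have "\<bar>pi * pi - 3.14159265359 * 3.14159265359\<bar> \<le> 
        \<bar>3.14159265359\<bar> * (1/10^9) + \<bar>3.14159265359\<bar> * (1/10^9) + (1/10^9) * (1/10^9)"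
      by (rule abs_mult_diff_le) (use pi_approx in \<open>simp_all add: abs_le_iff\<close>)
    then show ?thesis
      unfolding abs_le_iff power2_eq_square by simp
  qed
  \<comment> \<open>\<open>Complex c d\<close> is the second factor of the product in
    \<open>eq\<close>, an approximation of \<open>z0\<close>.\<close>
  define a b c d where "a = Re (Ln w_approx)" and "b = Im (Ln w_approx)" and "c = Re (Ln v_approx)"
    and "d = Im (Ln v_approx) + 2 * pi"
  have a: "\<bar>a - (-0.06807616)\<bar> \<le> 1/10^8" and b: "\<bar>b - (-0.19657613)\<bar> \<le> 1/10^8"
    and c: "\<bar>c - (-1.6055275)\<bar> \<le> 1/10^6"
    using Ln_w_approx Ln_v_approx by (simp_all add: a_def b_def c_def)
  have d: "\<bar>d - 7.4234262\<bar> \<le> 2/10^6"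
    using Ln_v_approx(2) pi_approx unfolding d_def abs_le_iff by simp
  note prods = abs_mult_diff_le[OF a c] abs_mult_diff_le[OF a d] abs_mult_diff_le[OF b c] abs_mult_diff_le[OF b d]
  let ?D = "dilog v_approx - Complex 0.07636763 0.18974971"
  have "\<bar>Re ?D\<bar> \<le> 1/10^6" "\<bar>Im ?D\<bar> \<le> 1/10^6"
    using dilog_v_approx abs_Re_le_cmod[of ?D] abs_Im_le_cmod[of ?D] by linarith+
  then have D: "\<bar>Re (dilog v_approx) - 0.07636763\<bar> \<le> 1/10^6" "\<bar>Im (dilog v_approx) - 0.18974971\<bar> \<le> 1/10^6"
    by simp_all
  have re: "Re (dilog_eqn w_approx) = pi\<^sup>2 / 6 - Re (dilog v_approx) - (a * c - b * d)"
    and im: "Im (dilog_eqn w_approx) = - Im (dilog v_approx) - (a * d + b * c)"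
    unfolding eq by (simp_all add: a_def b_def c_def d_def algebra_simps)
  have "\<bar>Re (dilog_eqn w_approx)\<bar> \<le> 25/10^7"
    using prods pi2 D unfolding re abs_le_iff by simp
  moreover have "\<bar>Im (dilog_eqn w_approx)\<bar> \<le> 25/10^7"
    using prods D unfolding im abs_le_iff by simp
  ultimately show ?thesis
    using cmod_le[of "dilog_eqn w_approx"] by simp
qed

text \<open>For the last bound: \<open>1 - w\<close> is close to \<open>v_approx\<close>, of modulus
  about 0.2, and there the derivative of \<open>Ln\<close> has modulus at most 10.\<close>

lemma ball_w_approx:
  assumes "w \<in> ball w_approx (1/10^6)"
  shows "norm w < 1" "norm w > 0.9" "w \<notin> \<real>\<^sub>\<le>\<^sub>0" "norm (Ln (1 - w) - Ln v_approx) \<le> 1/10^5"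
proof -
  have nw: "norm w_approx \<le> 0.94" "norm w_approx \<ge> 0.93"
    unfolding w_approx_def by (rule norm_Complex_le norm_Complex_ge; simp)+
  have d: "norm (w - w_approx) \<le> 1/10^6"
    using assms by (simp add: dist_norm norm_minus_commute)
  show "norm w < 1" "norm w > 0.9"
    using nw d norm_triangle_ineq2[of w w_approx] norm_triangle_ineq2[of w_approx w]
    by (simp_all add: norm_minus_commute)
  have "Re w > 0"
    using d abs_Re_le_cmod[of "w - w_approx"] by (simp add: w_approx_def)
  then show "w \<notin> \<real>\<^sub>\<le>\<^sub>0" by (auto simp: complex_nonpos_Reals_iff)
  have "norm (Ln (1 - w) - Ln v_approx) \<le> 10 * norm ((1 - w) - v_approx)"
  proof (rule field_differentiable_bound[where f' = inverse])
    show "convex (ball v_approx (2/10^6))" by simp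
    fix z assume z: "z \<in> ball v_approx (2/10^6)"
    have "norm v_approx \<ge> 0.2"
      unfolding v_approx_def by (rule norm_Complex_ge) simp
    moreover have "norm (v_approx - z) < 2/10^6" using z by (simp add: dist_norm)
    ultimately have n: "norm z \<ge> 0.1"
      using norm_triangle_ineq2[of v_approx z] by simp
    then show "norm (inverse z) \<le> 10"
      by (simp add: norm_inverse norm_divide divide_simps split: if_splits)
    have "Re z > 0"
      using \<open>norm (v_approx - z) < 2/10^6\<close> abs_Re_le_cmod[of "v_approx - z"] by (simp add: v_approx_def)
    then have "z \<notin> \<real>\<^sub>\<le>\<^sub>0" by (auto simp: complex_nonpos_Reals_iff)
    then show "(Ln has_field_derivative inverse z) (at z within ball v_approx (2/10^6))"
      by (rule has_field_derivative_at_within[OF has_field_derivative_Ln])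
  qed (use d in \<open>auto simp: dist_norm norm_minus_commute one_minus_w_approx[symmetric]\<close>)
  also have "\<dots> \<le> 10 * (1/10^6)"
    using d by (auto simp: norm_minus_commute one_minus_w_approx[symmetric])
  finally show "norm (Ln (1 - w) - Ln v_approx) \<le> 1/10^5" by simp
qed

text \<open>The derivative of \<open>dilog_eqn\<close> at \<open>w_approx\<close>, rounded to two
  decimals.\<close>

definition newton_slope :: complex where
  "newton_slope = Complex 3.24 (-7.46)"

lemma newton_slope_ge: "norm newton_slope \<ge> 8"
  unfolding newton_slope_def by (rule norm_Complex_ge) simp

text \<open>The simplified Newton map is a contraction because its slope is close to the derivative
  \<open>- (Ln (1 - w) + 2 \<pi> \<i>) / w\<close> of the equation.\<close>

lemma newton_contraction:
  assumes "x \<in> ball w_approx (1/10^6)" "y \<in> ball w_approx (1/10^6)"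
  shows "norm ((x - dilog_eqn x / newton_slope) - (y - dilog_eqn y / newton_slope)) \<le> 1/10 * norm (x - y)"
proof (rule field_differentiable_bound[where S = "ball w_approx (1/10^6)"
      and f' = "\<lambda>w. 1 - (- Ln (1 - w) / w - 2 * of_real pi * \<i> / w) / newton_slope"])
  fix w assume w: "w \<in> ball w_approx (1/10^6)"
  note bw = ball_w_approx[OF w]
  have nz: "newton_slope \<noteq> 0" using newton_slope_ge by auto
  have w0: "w \<noteq> 0" using bw by auto
  show "((\<lambda>w. w - dilog_eqn w / newton_slope) has_field_derivative
      1 - (- Ln (1 - w) / w - 2 * of_real pi * \<i> / w) / newton_slope) (at w within ball w_approx (1/10^6))"
    unfolding dilog_eqn_def
    by (rule has_field_derivative_at_within)
      (use bw w0 nz in \<open>auto intro!: derivative_eq_intros dilog_has_field_derivative simp: divide_simps\<close>)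
  have Ln: "\<bar>Re (Ln (1 - w)) + 1.6055275\<bar> \<le> 1/10^4" "\<bar>Im (Ln (1 - w)) - 1.1402409\<bar> \<le> 1/10^4"
    using bw(4) abs_Re_le_cmod[of "Ln (1 - w) - Ln v_approx"] abs_Im_le_cmod[of "Ln (1 - w) - Ln v_approx"]
      Ln_v_approx unfolding minus_complex.sel abs_le_iff by simp_all
  have d: "norm (w - w_approx) \<le> 1/10^6"
    using w by (simp add: dist_norm norm_minus_commute)
  then have r: "\<bar>Re w - 0.91619782\<bar> \<le> 1/10^6" "\<bar>Im w - (-0.18245890)\<bar> \<le> 1/10^6"
    using abs_Re_le_cmod[of "w - w_approx"] abs_Im_le_cmod[of "w - w_approx"]
    by (simp_all add: w_approx_def)
  let ?u = "newton_slope * w + Ln (1 - w) + 2 * of_real pi * \<i>"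
  have "\<bar>Re ?u\<bar> \<le> 1/100" "\<bar>Im ?u\<bar> \<le> 1/100"
    using Ln r pi_approx unfolding abs_le_iff by (simp_all add: newton_slope_def)
  then have u: "norm ?u \<le> 2/100"
    using cmod_le[of ?u] by linarith
  have "1 - (- Ln (1 - w) / w - 2 * of_real pi * \<i> / w) / newton_slope = ?u / (newton_slope * w)"
    using nz w0 by (simp add: field_simps)
  moreover have "norm (?u / (newton_slope * w)) \<le> (2/100) / (8 * 0.9)"
    unfolding norm_divide norm_mult using u bw newton_slope_ge
    by (intro frac_le mult_mono) auto
  ultimately show "norm (1 - (- Ln (1 - w) / w - 2 * of_real pi * \<i> / w) / newton_slope) \<le> 1/10"
    by simp
qed (use assms in auto)

text \<open>Banach's theorem gives a fixed point in a slightly smaller closed, hence complete, ball.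
  The contraction estimate on the whole open ball makes it unique there, so the \<open>THE\<close>
  in \<open>w0\<close> denotes it.\<close>

lemma w0_in_ball: "w0 \<in> ball w_approx (1/10^6)"
proof -
  define T where "T w = w - dilog_eqn w / newton_slope" for w
  have nz: "newton_slope \<noteq> 0" using newton_slope_ge by auto
  have fix_iff: "T w = w \<longleftrightarrow> dilog w = 2 * of_real pi * \<i> * Ln w" for w
    using nz by (simp add: T_def dilog_eqn_def)
  \<comment> \<open>The radius \<open>9/10^7\<close> leaves room for the self-map property: the
    centre moves by at most \<open>6.25/10^7\<close>, and the contraction adds at most
    \<open>0.9/10^7\<close>.\<close>
  have sub: "cball w_approx (9/10^7) \<subseteq> ball w_approx (1/10^6)"
    by (simp add: subset_iff)
  have "\<exists>!w\<in>cball w_approx (9/10^7). T w = w"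
  proof (rule Banach_fix[where c = "1/10"])
    show "T ` cball w_approx (9/10^7) \<subseteq> cball w_approx (9/10^7)"
    proof clarify
      fix w assume w: "w \<in> cball w_approx (9/10^7)"
      have "norm (T w - T w_approx) \<le> 1/10 * norm (w - w_approx)"
        unfolding T_def by (rule newton_contraction) (use w sub in auto)
      moreover have "norm (w - w_approx) \<le> 9/10^7"
        using w by (simp add: dist_norm norm_minus_commute)
      moreover have "norm (T w_approx - w_approx) \<le> (5/10^6) / 8"
      proof -
        have "norm (T w_approx - w_approx) = norm (dilog_eqn w_approx) / norm newton_slope"
          by (simp add: T_def norm_divide)
        also have "\<dots> \<le> (5/10^6) / 8"
          by (rule frac_le[OF _ norm_dilog_eqn_w_approx _ newton_slope_ge]) simp_all
        finally show ?thesis .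
      qed
      ultimately have "norm (T w - w_approx) \<le> 9/10^7"
        using norm_triangle_ineq[of "T w - T w_approx" "T w_approx - w_approx"] by simp
      then show "T w \<in> cball w_approx (9/10^7)"
        by (simp add: dist_norm norm_minus_commute)
    qed
    show "dist (T x) (T y) \<le> 1/10 * dist x y"
      if "x \<in> cball w_approx (9/10^7)" "y \<in> cball w_approx (9/10^7)" for x y
      unfolding T_def dist_norm by (rule newton_contraction) (use that sub in auto)
  qed (auto simp: complete_eq_closed)
  then obtain w where w: "w \<in> cball w_approx (9/10^7)" "T w = w"
    by blast
  have "w0 = w"
    unfolding w0_def w_approx_def[symmetric]
  proof (rule the_equality)
    show "w \<in> ball w_approx (1/10^6) \<and> dilog w = 2 * pi * \<i> * Ln w"
      using w sub fix_iff by auto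
    fix y assume y: "y \<in> ball w_approx (1/10^6) \<and> dilog y = 2 * pi * \<i> * Ln y"
    then have "T y = y" using fix_iff by auto
    moreover have "norm (T y - T w) \<le> 1/10 * norm (y - w)"
      unfolding T_def by (rule newton_contraction) (use y w sub in auto)
    ultimately show "y = w" using w by simp
  qed
  with w sub show ?thesis by auto
qed

text \<open>The segments depend on \<open>w0\<close> only through \<open>Re cc\<close>, and this
  precision suffices for all rate estimates.\<close>

lemma Re_cc_bounds: "- 0.2164 \<le> Re cc" "Re cc \<le> - 0.2162"
proof -
  note bw = ball_w_approx[OF w0_in_ball]
  have Ln: "\<bar>Re (Ln (1 - w0)) + 1.6055275\<bar> \<le> 1/10^4" "\<bar>Im (Ln (1 - w0)) - 1.1402409\<bar> \<le> 1/10^4"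
    using bw(4) abs_Re_le_cmod[of "Ln (1 - w0) - Ln v_approx"] abs_Im_le_cmod[of "Ln (1 - w0) - Ln v_approx"]
      Ln_v_approx unfolding minus_complex.sel abs_le_iff by simp_all
  have z: "\<bar>Re z0 + 1.6055275\<bar> \<le> 1/10^4" "\<bar>Im z0 - 7.4234262\<bar> \<le> 2/10^4"
    using Ln pi_approx unfolding z0_def abs_le_iff by simp_all
  have "Re cc = Re z0 / Im z0" by (simp add: cc_def)
  moreover have "Im z0 > 0" "- 0.2164 * Im z0 \<le> Re z0" "Re z0 \<le> - 0.2162 * Im z0"
    using z unfolding abs_le_iff by simp_all
  ultimately show "- 0.2164 \<le> Re cc" "Re cc \<le> - 0.2162"
    by (simp_all only: pos_le_divide_eq pos_divide_le_eq)
qed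

lemma Im_cc [simp]: "Im cc = 1"
  by (simp add: cc_def)

section \<open>Bounds along the segments\<close>

lemma norm_one_minus_exp_ge: "norm (1 - exp w) \<ge> 2 * exp (Re w / 2) * \<bar>sin (Im w / 2)\<bar>"
proof (rule power2_le_imp_le)
  define e where "e = exp (Re w / 2)"
  have e: "exp (Re w) = e\<^sup>2"
    by (simp add: e_def flip: exp_double)
  have "(2 * exp (Re w / 2) * \<bar>sin (Im w / 2)\<bar>)\<^sup>2 = 2 * e\<^sup>2 * (2 * (sin (Im w / 2))\<^sup>2)"
    by (simp add: power_mult_distrib e_def)
  also have "2 * (sin (Im w / 2))\<^sup>2 = 1 - cos (Im w)"
    using cos_double_sin[of "Im w / 2"] by simp
  \<comment> \<open>With the added square \<open>(exp (Re w) - 1)\<^sup>2\<close> the expression is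
    exactly \<open>|1 - exp w|\<^sup>2\<close>.\<close>
  also have "2 * e\<^sup>2 * (1 - cos (Im w)) \<le> (e\<^sup>2 - 1)\<^sup>2 + 2 * e\<^sup>2 * (1 - cos (Im w))"
    by simp
  also have "\<dots> = (1 - e\<^sup>2 * cos (Im w))\<^sup>2 + (e\<^sup>2 * sin (Im w))\<^sup>2"
  proof -
    have "(sin (Im w))\<^sup>2 = 1 - (cos (Im w))\<^sup>2"
      by (rule sin_squared_eq)
    then show ?thesis
      unfolding power_mult_distrib by (simp only:) (simp add: power2_eq_square algebra_simps)
  qed
  also have "\<dots> = (norm (1 - exp w))\<^sup>2"
    by (simp add: cmod_power2 Re_exp Im_exp e)
  finally show "(2 * exp (Re w / 2) * \<bar>sin (Im w / 2)\<bar>)\<^sup>2 \<le> (norm (1 - exp w))\<^sup>2" .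
qed simp

text \<open>The constant \<open>0.275\<close> must be small enough that
  \<open>ln 5 - 1 - \<pi> / 40 - 0.275 (4 \<pi> / 5)\<^sup>2 / 3 \<ge> - 0.05\<close>, which is the rate obtained on the second segment.\<close>

lemma sin_ge_gaussian:
  assumes "0 \<le> \<theta>" "\<theta> \<le> 4 * pi / 5"
  shows "\<theta> * exp (- 0.275 * \<theta>\<^sup>2) \<le> sin \<theta>"
proof (cases "\<theta> = 0")
  case False
  define s where "s = \<theta>\<^sup>2"
  have s0: "0 \<le> s" by (simp add: s_def)
  have s1: "s \<le> 6.3167"
  proof -
    have "\<theta> \<le> 2.51328" using assms pi_approx by simp
    then have "\<theta> * \<theta> \<le> 2.51328 * 2.51328" using assms by (intro mult_mono) auto
    then show ?thesis by (simp add: s_def power2_eq_square)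
  qed
  have "\<theta> > 0" using assms False by simp
  then obtain t where t: "sin \<theta> = (\<Sum>m<7. sin_coeff m * \<theta> ^ m) + (sin (t + 1/2 * real 7 * pi) / fact 7) * \<theta> ^ 7"
    using Maclaurin_sin_expansion3[of 7 \<theta>] by auto
  have "(\<Sum>m<7. sin_coeff m * \<theta> ^ m) = \<theta> * (1 - s/6 + s\<^sup>2/120)"
  proof -
    have "(\<Sum>m<7. sin_coeff m * \<theta> ^ m) = \<theta> - \<theta> ^ 3 / 6 + \<theta> ^ 5 / 120"
      by (simp add: lessThan_nat_numeral sin_coeff_def fact_numeral)
    then show ?thesis
      by (simp add: s_def eval_nat_numeral algebra_simps)
  qed
  moreover have "(sin (t + 1/2 * real 7 * pi) / fact 7) * \<theta> ^ 7 \<ge> (-1 / 5040) * \<theta> ^ 7"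
    using assms by (intro mult_right_mono) (auto simp: fact_numeral)
  moreover have "\<theta> ^ 7 = \<theta> * s ^ 3"
    by (simp add: s_def flip: power_mult power_Suc)
  ultimately have sin: "sin \<theta> \<ge> \<theta> * (1 - s/6 + s^2/120 - s^3/5040)"
    unfolding t by (simp add: algebra_simps)
  \<comment> \<open>\<open>?p\<close> is a lower bound for \<open>sin \<theta> / \<theta>\<close>
    and \<open>?q\<close> the cubic Taylor polynomial of \<open>exp ?u\<close>. Once
    \<open>?p * ?q \<ge> 1\<close> is known,
    \<open>?p \<ge> 1 / ?q \<ge> exp (- ?u)\<close>.\<close>
  let ?p = "1 - s/6 + s^2/120 - s^3/5040"
  let ?u = "0.275 * s"
  let ?q = "1 + ?u + ?u\<^sup>2 / 2 + ?u ^ 3 / 6"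
  have q: "?q \<le> exp ?u"
    using sum_exp_series_le[of "{..<4}" ?u] s0 by (simp add: eval_nat_numeral fact_numeral)
  have "?p * ?q \<ge> 1"
  proof -
    \<comment> \<open>\<open>6.3167\<close> exceeds \<open>(4 \<pi> / 5)\<^sup>2\<close>. Each
      inequality trades a power of \<open>s\<close> for the one below it, which reduces the claim to
      linear arithmetic in the powers.\<close>
    have m: "s ^ 2 \<le> 63167/10000 * s" "s ^ 3 \<le> 63167/10000 * s ^ 2"
      "s ^ 4 \<le> 63167/10000 * s ^ 3" "s ^ 6 \<le> 63167/10000 * s ^ 5"
      using mult_right_mono[OF s1, of s] mult_right_mono[OF s1, of "s^2"] mult_right_mono[OF s1, of "s^3"]
        mult_right_mono[OF s1, of "s^5"] s0
      by (simp_all add: eval_nat_numeral)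
    have "?p * ?q = 1 + 13/120 * s + 1/3200 * s^2 - 5989/8064000 * s^3 - 341/1075200 * s^4
        + 2299/107520000 * s^5 - 1331/1935360000 * s^6"
      by (simp add: field_simps) (simp add: eval_nat_numeral algebra_simps)
    moreover have "0 \<le> s ^ 5" "0 \<le> s ^ 2" using s0 by auto
    ultimately show ?thesis
      using m s0 by linarith
  qed
  moreover have "?q > 0" using s0 by (simp add: add_pos_nonneg)
  ultimately have "1 / ?q \<le> ?p"
    by (simp only: pos_divide_le_eq)
  moreover have "exp (- ?u) \<le> 1 / ?q"
    using q \<open>?q > 0\<close> by (simp only: exp_minus inverse_eq_divide) (rule divide_left_mono, auto)
  ultimately have "\<theta> * exp (- ?u) \<le> \<theta> * ?p"
    using assms by (intro mult_left_mono) auto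
  with sin show ?thesis
    by (simp add: s_def)
qed simp

text \<open>Already \<open>|1 - exp w| \<ge> Re w\<close> suffices: the product is at least
  \<open>(2 \<pi>) ^ N * N! / N ^ N\<close>, and \<open>2 \<pi> \<ge> exp 1\<close>. The
  \<open>- 0\<close> fits the common form with an additive constant \<open>G\<close>.\<close>

lemma qpoch_exp_ge_L1:
  assumes "Re z = 2 * pi" "N \<ge> 1"
  shows "norm (qpoch (exp (z / of_nat N)) N) \<ge> exp (- 0.05 * real N - 0)"
proof -
  have e: "exp 1 \<le> 2 * pi" using e_less_272 pi_gt3 by simp
  have "exp (- 0.05 * real N - 0) \<le> exp (- real N) * exp (real N)"
    by (simp flip: exp_add)
  also have "exp (real N) = (\<Prod>k = 1..N. exp 1)"
    by (simp flip: exp_of_nat_mult)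
  also have "exp (- real N) * (\<Prod>k = 1..N. exp 1) \<le> (\<Prod>k = 1..N. real k / real N) * (\<Prod>k = 1..N. 2 * pi)"
    by (intro mult_mono exp_minus_le_prod_fractions assms prod_mono prod_nonneg) (use e in auto)
  also have "\<dots> = (\<Prod>k = 1..N. real k / real N * (2 * pi))"
    by (simp only: prod.distrib)
  also have "\<dots> \<le> (\<Prod>k = 1..N. norm (1 - exp (of_real (real k / real N) * z)))"
  proof (intro prod_mono conjI)
    fix k
    let ?w = "of_real (real k / real N) * z"
    have "Re ?w = real k / real N * (2 * pi)" using assms by simp
    moreover have "Re ?w \<le> exp (Re ?w) - 1"
      using exp_ge_add_one_self[of "Re ?w"] by linarith
    moreover have "exp (Re ?w) - 1 \<le> norm (1 - exp ?w)"
      using norm_triangle_ineq2[of "exp ?w" 1] by (simp add: norm_minus_commute)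
    ultimately show "real k / real N * (2 * pi) \<le> norm (1 - exp ?w)" by linarith
  qed auto
  finally show ?thesis by (simp only: norm_qpoch_exp)
qed

text \<open>Here \<open>Re z\<close> changes sign, so \<open>qpoch_exp_ge\<close> does not cover the
  segment. Instead \<open>norm_one_minus_exp_ge\<close> and the Gaussian minorant of the sine bound
  each factor by \<open>t * exp (g t)\<close> with a quadratic polynomial \<open>g\<close>.\<close>

lemma qpoch_exp_ge_L2:
  assumes "- pi / 10 \<le> Re z" "Im z = 8 * pi / 5" "N \<ge> 1"
  shows "norm (qpoch (exp (z / of_nat N)) N) \<ge> exp (- 0.05 * real N - 10)"
proof -
  define a b where "a = pi / 20" and "b = 0.275 * (4 * pi / 5)\<^sup>2"
  have ab: "0 \<le> a" "0 \<le> b" "a \<le> 0.15708" "b \<le> 1.7371"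
  proof -
    have "pi * pi \<le> 3.141593 * 3.141593" using pi_approx by (intro mult_mono) auto
    then show "b \<le> 1.7371" by (simp add: b_def power2_eq_square)
  qed (use pi_approx in \<open>auto simp: a_def b_def\<close>)
  \<comment> \<open>\<open>ln 5\<close> stems from \<open>8 \<pi> / 5 \<ge> 5\<close>,
    \<open>a\<close> from \<open>Re z \<ge> - \<pi> / 10\<close>, and \<open>b\<close> from the
    Gaussian at \<open>\<theta> = 4 \<pi> t / 5\<close>.\<close>
  define g where "g t = ln 5 - a * t - b * t\<^sup>2" for t :: real
  have ln5: "ln (5::real) \<ge> 1.609"
  proof -
    note ln_5_eq
    moreover have "ln 2 \<ge> (0.6931 :: real)"
      using ln_approx_bounds[of 2 4] by (simp add: eval_nat_numeral)
    moreover have "ln (5/4) \<ge> (0.2231 :: real)"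
      using ln_approx_bounds[of "5/4" 2] by (simp add: eval_nat_numeral)
    ultimately show ?thesis by simp
  qed
  have "(\<Sum>k = 1..N. g (real k / real N)) \<ge>
      real N * ((ln 5 * 1 - a * 1\<^sup>2 / 2 - b * 1 ^ 3 / 3) - (ln 5 * 0 - a * 0\<^sup>2 / 2 - b * 0 ^ 3 / 3)) - (a + 2 * b)"
  proof (rule riemann_sum_ge)
    show "((\<lambda>t. ln 5 * t - a * t\<^sup>2 / 2 - b * t ^ 3 / 3) has_real_derivative g t) (at t)" for t
      unfolding g_def by (auto intro!: derivative_eq_intros simp: power2_eq_square)
    fix s t :: real assume st: "0 < s" "s \<le> t" "t \<le> 1"
    have "g s - g t = (a + b * (s + t)) * (t - s)"
      by (simp add: g_def power2_eq_square algebra_simps)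
    moreover have "0 \<le> (a + b * (s + t)) * (t - s)"
      using st ab by (intro mult_nonneg_nonneg add_nonneg_nonneg) auto
    moreover have "(a + b * (s + t)) * (t - s) \<le> (a + 2 * b) * (t - s)"
      using st ab mult_left_mono[of "s + t" 2 b] by (intro mult_right_mono) auto
    ultimately show "\<bar>g t - g s\<bar> \<le> (a + 2 * b) * (t - s)"
      by (simp add: abs_if)
  qed (use assms ab in \<open>auto intro!: continuous_intros\<close>)
  \<comment> \<open>The integral of \<open>g\<close> is at least \<open>0.95\<close>; the factorial
    bound subtracts 1, which leaves the rate \<open>- 0.05\<close>. The 10 generously covers
    \<open>a + 2 * b\<close>.\<close>
  moreover have "real N * (ln 5 - a / 2 - b / 3) \<ge> real N * 0.95"
    using ln5 ab by (intro mult_left_mono) auto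
  ultimately have sum_g: "(\<Sum>k = 1..N. g (real k / real N)) \<ge> 0.95 * real N - 10"
    using ab by simp
  have "exp (- 0.05 * real N - 10) = exp (- real N) * exp (0.95 * real N - 10)"
    by (simp flip: exp_add)
  also have "\<dots> \<le> (\<Prod>k = 1..N. real k / real N) * exp (\<Sum>k = 1..N. g (real k / real N))"
    using exp_minus_le_prod_fractions[OF assms(3)] sum_g by (intro mult_mono) (auto intro: prod_nonneg)
  also have "\<dots> = (\<Prod>k = 1..N. real k / real N * exp (g (real k / real N)))"
    by (simp only: prod.distrib exp_sum finite_atLeastAtMost)
  also have "\<dots> \<le> norm (qpoch (exp (z / of_nat N)) N)"
    unfolding norm_qpoch_exp
  proof (intro prod_mono conjI)
    fix k assume k: "k \<in> {1..N}"
    define t where "t = real k / real N"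
    have t: "0 \<le> t" "t \<le> 1" using k by (auto simp: t_def)
    let ?\<theta> = "4 * pi / 5 * t"
    have th: "0 \<le> ?\<theta>" "?\<theta> \<le> 4 * pi / 5"
      using t mult_left_mono[of t 1 "4 * pi / 5"] by auto
    have "t * exp (g t) = 5 * t * (exp (- a * t) * exp (- b * t\<^sup>2))"
      unfolding g_def by (simp add: exp_diff exp_minus divide_simps)
    also have "\<dots> \<le> 8 * pi / 5 * t * (exp (t * Re z / 2) * exp (- b * t\<^sup>2))"
    proof (intro mult_mono)
      show "exp (- a * t) \<le> exp (t * Re z / 2)"
        using assms(1) t mult_left_mono[of "- pi / 10" "Re z" t] by (simp add: a_def mult.commute)
    qed (use t pi_approx in auto)
    also have "\<dots> = 2 * exp (t * Re z / 2) * (?\<theta> * exp (- 0.275 * ?\<theta>\<^sup>2))"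
      by (simp add: b_def power_mult_distrib power_divide mult_ac)
    also have "\<dots> \<le> 2 * exp (t * Re z / 2) * \<bar>sin ?\<theta>\<bar>"
      using sin_ge_gaussian[OF th] by (intro mult_left_mono) auto
    also have "\<dots> = 2 * exp (Re (of_real t * z) / 2) * \<bar>sin (Im (of_real t * z) / 2)\<bar>"
    proof -
      have "Re (of_real t * z) = t * Re z" "Im (of_real t * z) / 2 = ?\<theta>"
        using assms(2) by simp_all
      then show ?thesis by (simp only:)
    qed
    also have "\<dots> \<le> norm (1 - exp (of_real t * z))"
      by (rule norm_one_minus_exp_ge)
    finally show "real k / real N * exp (g (real k / real N)) \<le> norm (1 - exp (of_real (real k / real N) * z))"
      by (simp only: t_def)
  qed auto
  finally show ?thesis .
qed

text \<open>On the segments in the left half-plane the exponential rate is the real part of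
  \<open>(dilog (exp z) - \<pi>\<^sup>2 / 6) / z\<close>.\<close>

definition rate_ok :: "complex \<Rightarrow> bool" where
  "rate_ok z \<longleftrightarrow> Re z < 0 \<and> Re ((of_real (pi\<^sup>2 / 6) - dilog (exp z)) / z) \<ge> - 0.05"

text \<open>Multiplying by \<open>|z|\<^sup>2\<close> removes the quotient and leaves a real
  inequality to check on each segment.\<close>

lemma rate_okI:
  assumes "Re z < 0"
    "(pi\<^sup>2 / 6 - Re (dilog (exp z))) * (- Re z) + Im (dilog (exp z)) * Im z \<le> 0.05 * ((Re z)\<^sup>2 + (Im z)\<^sup>2)"
  shows "rate_ok z"
proof -
  let ?u = "of_real (pi\<^sup>2 / 6) - dilog (exp z)"
  have "(Re z)\<^sup>2 + (Im z)\<^sup>2 > 0"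
    using assms(1) by (intro add_pos_nonneg) auto
  moreover have "- 0.05 * ((Re z)\<^sup>2 + (Im z)\<^sup>2) \<le> Re ?u * Re z + Im ?u * Im z"
    using assms(2) by (simp add: algebra_simps)
  ultimately show ?thesis
    using assms(1) by (simp only: rate_ok_def Re_divide pos_le_divide_eq simp_thms)
qed

lemma pi_squared_le: "pi\<^sup>2 / 6 \<le> 1.645"
proof -
  have "pi * pi \<le> 3.1416 * 3.1416" using pi_approx by (intro mult_mono) auto
  then show ?thesis by (simp add: power2_eq_square)
qed

lemma norm_dilog_le:
  assumes "norm w \<le> r" "r < 1"
  shows "norm (dilog w) \<le> r / (1 - r)"
proof -
  have "norm (dilog w) \<le> norm w / (1 - norm w)"
    using dilog_approx[of w 0] assms by simp
  also have "\<dots> \<le> r / (1 - r)"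
    using assms by (intro frac_le) (auto intro: order_trans[OF norm_ge_zero])
  finally show ?thesis .
qed

text \<open>So far to the left \<open>dilog (exp z)\<close> is negligible, and
  \<open>\<pi>\<^sup>2 / 6\<close> divided by \<open>20 \<pi>\<close> is well below 0.05.\<close>

lemma rate_ok_L7:
  assumes "Re z = - 20 * pi" "0 \<le> Im z" "Im z \<le> 6 * pi"
  shows "rate_ok z"
proof (rule rate_okI)
  let ?L = "dilog (exp z)"
  have "exp (20 * pi) \<ge> 61"
    using exp_ge_add_one_self[of "20 * pi"] pi_gt3 by linarith
  then have "norm (exp z) \<le> 1/61"
    using assms by (simp add: exp_minus divide_simps)
  then have "norm ?L \<le> 1/60"
    using norm_dilog_le[of "exp z" "1/61"] by simp
  then have L: "Re ?L \<ge> - 1/60" "Im ?L \<le> 1/60"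
    using abs_Re_le_cmod[of ?L] abs_Im_le_cmod[of ?L] by linarith+
  have "(pi\<^sup>2 / 6 - Re ?L) * (20 * pi) \<le> 2 * (20 * pi)"
    using L pi_squared_le by (intro mult_right_mono) auto
  moreover have "Im ?L * Im z \<le> 1/60 * (6 * pi)"
    using L assms by (intro mult_mono) auto
  moreover have "0.05 * (20 * pi)\<^sup>2 \<ge> 20 * pi * 3"
    using mult_left_mono[of 3 pi "20 * pi"] pi_gt3 by (simp add: power2_eq_square)
  moreover have "0 \<le> 0.05 * (Im z)\<^sup>2" by simp
  ultimately have "(pi\<^sup>2 / 6 - Re ?L) * (20 * pi) + Im ?L * Im z \<le> 0.05 * (20 * pi)\<^sup>2 + 0.05 * (Im z)\<^sup>2"
    using pi_gt3 by linarith
  then show "(pi\<^sup>2 / 6 - Re ?L) * (- Re z) + Im ?L * Im z \<le> 0.05 * ((Re z)\<^sup>2 + (Im z)\<^sup>2)"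
    using assms by (simp add: algebra_simps)
qed (use assms in simp)

lemma exp_neg_le_of_nat:
  assumes "x \<le> - real n" shows "exp x \<le> (2/5) ^ n"
proof -
  have "exp x \<le> exp (- real n)" using assms by simp
  also have "\<dots> = exp (-1) ^ n" by (simp flip: exp_of_nat_mult)
  also have "\<dots> \<le> (2/5) ^ n"
  proof (rule power_mono)
    have "exp (1::real) \<ge> 5/2"
      using sum_exp_series_le[of "{..<3}" 1] by (simp add: eval_nat_numeral fact_numeral)
    then show "exp (-1::real) \<le> 2/5" by (simp add: exp_minus divide_simps)
  qed simp
  finally show ?thesis .
qed

text \<open>The inequality \<open>x\<^sup>2 + (6 \<pi>)\<^sup>2 \<ge> 12 \<pi> x\<close> makes the
  claim linear in \<open>x\<close>: the coefficient \<open>0.6 \<pi>\<close> exceeds 1.672, and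
  \<open>x \<ge> 4\<close> absorbs the contribution of \<open>Im (dilog (exp z))\<close>.\<close>

lemma rate_ok_L6:
  assumes "Im z = 6 * pi" "Re z \<le> - 4"
  shows "rate_ok z"
proof (rule rate_okI)
  let ?L = "dilog (exp z)"
  define x where "x = - Re z"
  have x: "x \<ge> 4" using assms by (simp add: x_def)
  have "norm (exp z) \<le> 16/625"
    using exp_neg_le_of_nat[of "Re z" 4] assms by (simp add: eval_nat_numeral)
  then have "norm ?L \<le> 16/609"
    using norm_dilog_le[of "exp z" "16/625"] by simp
  then have L: "Re ?L \<ge> - 0.027" "Im ?L \<le> 0.027"
    using abs_Re_le_cmod[of ?L] abs_Im_le_cmod[of ?L] by simp_all
  define A B C D where "A = (pi\<^sup>2 / 6 - Re ?L) * x" and "B = Im ?L * pi" and "C = x * pi"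
    and "D = x\<^sup>2 + (6 * pi)\<^sup>2"
  have "A \<le> 1.672 * x"
    unfolding A_def using L pi_squared_le x by (intro mult_right_mono) auto
  moreover have "B \<le> 0.027 * pi"
    unfolding B_def using L by (intro mult_right_mono) auto
  moreover have "12 * C \<le> D"
    using sum_squares_bound[of x "6 * pi"] by (simp add: C_def D_def)
  moreover have "x * 3.14 \<le> C"
    unfolding C_def using x pi_approx by (intro mult_left_mono) auto
  ultimately have "A + 6 * B \<le> 0.05 * D"
    using x pi_approx by simp
  then show "(pi\<^sup>2 / 6 - Re ?L) * (- Re z) + Im ?L * Im z \<le> 0.05 * ((Re z)\<^sup>2 + (Im z)\<^sup>2)"
    unfolding assms(1) A_def B_def D_def x_def by (simp add: mult_ac)
qed (use assms in simp)

text \<open>On this ray \<open>z = s (\<rho> + \<i>)\<close>, so the inequality can be divided by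
  \<open>s\<close>, after which its right-hand side grows with \<open>s\<close>.\<close>

lemma rate_ok_L5:
  assumes "Re z = \<rho> * s" "Im z = s" "3 * pi \<le> s" "s \<le> 6 * pi" "- 0.2164 \<le> \<rho>" "\<rho> \<le> - 0.2162"
  shows "rate_ok z"
proof (rule rate_okI)
  let ?L = "dilog (exp z)"
  define \<sigma> where "\<sigma> = - \<rho>"
  have sg: "0.2162 \<le> \<sigma>" "\<sigma> \<le> 0.2164" using assms by (auto simp: \<sigma>_def)
  have s: "s \<ge> 9.42" using assms pi_approx by simp
  have x: "Re z \<le> - 2"
    using mult_mono[OF sg(1) s] sg s assms by (simp add: \<sigma>_def)
  have w: "norm (exp z) \<le> 4/25"
    using exp_neg_le_of_nat[of "Re z" 2] x by (simp add: eval_nat_numeral)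
  have "(pi\<^sup>2 / 6 - Re ?L) * \<sigma> + Im ?L \<le> 0.05 * s * (1 + \<sigma>\<^sup>2)"
  proof -
    have sq: "\<sigma>\<^sup>2 \<ge> 0.0467"
      using mult_mono[OF sg(1) sg(1)] sg by (simp add: power2_eq_square)
    have p: "pi\<^sup>2 / 6 * \<sigma> \<le> 1.645 * 0.2164"
      using pi_squared_le sg by (intro mult_mono) auto
    show ?thesis
    \<comment> \<open>Up to \<open>4 \<pi>\<close> the right-hand side is too small for the crude
      bound on \<open>|dilog (exp z)|\<close>, but there \<open>sin s \<le> 0\<close>, so the
      leading term \<open>exp z\<close> does not contribute positively to the imaginary
      part.\<close>
    proof (cases "s \<le> 4 * pi")
      case True
      define E where "E = ?L - exp z"
      have "norm E \<le> norm (exp z) ^ 2 / 4 / (1 - norm (exp z))"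
        using dilog_approx[of "exp z" 1] x by (simp add: E_def eval_nat_numeral)
      also have "\<dots> \<le> (4/25) ^ 2 / 4 / (1 - 4/25)"
        using w by (intro frac_le divide_right_mono power_mono) auto
      finally have "norm E \<le> 0.01" by (simp add: eval_nat_numeral)
      then have E: "- 0.01 \<le> Re E" "Im E \<le> 0.01"
        using abs_Re_le_cmod[of E] abs_Im_le_cmod[of E] by simp_all
      have "sin s \<le> 0"
      proof -
        have "sin ((s - pi) - 2 * pi) \<ge> 0"
          by (rule sin_ge_zero) (use True assms(3) in auto)
        then show ?thesis by (simp add: sin_diff)
      qed
      then have "Im (exp z) \<le> 0"
        using assms by (simp add: Im_exp mult_nonneg_nonpos)
      moreover have "Re (exp z) \<ge> - 4/25"
        using w abs_Re_le_cmod[of "exp z"] by linarith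
      ultimately have L: "Im ?L \<le> 0.01" "Re ?L \<ge> - 0.17"
        using E by (simp_all add: E_def)
      have "(- Re ?L) * \<sigma> \<le> 0.17 * 0.2164"
      proof -
        have "(- Re ?L) * \<sigma> \<le> 0.17 * \<sigma>" using L sg by (intro mult_right_mono) auto
        then show ?thesis using sg by simp
      qed
      moreover have "0.05 * s * (1 + \<sigma>\<^sup>2) \<ge> 0.05 * 9.42 * (1 + 0.0467)"
        using s sq by (intro mult_mono) auto
      ultimately show ?thesis using p L by (simp add: left_diff_distrib)
    next
      case False
      have "norm ?L \<le> 4/21"
        using norm_dilog_le[OF w] by simp
      then have L: "Im ?L \<le> 4/21" "Re ?L \<ge> - 4/21"
        using abs_Re_le_cmod[of ?L] abs_Im_le_cmod[of ?L] by linarith+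
      have "(- Re ?L) * \<sigma> \<le> 4/21 * 0.2164"
      proof -
        have "(- Re ?L) * \<sigma> \<le> 4/21 * \<sigma>" using L sg by (intro mult_right_mono) auto
        then show ?thesis using sg by simp
      qed
      moreover have "0.05 * s * (1 + \<sigma>\<^sup>2) \<ge> 0.05 * 12.56 * (1 + 0.0467)"
        using False pi_approx sq by (intro mult_mono) auto
      ultimately show ?thesis using p L by (simp add: left_diff_distrib)
    qed
  qed
  then have "s * ((pi\<^sup>2 / 6 - Re ?L) * \<sigma> + Im ?L) \<le> s * (0.05 * s * (1 + \<sigma>\<^sup>2))"
    using s by (intro mult_left_mono) auto
  then show "(pi\<^sup>2 / 6 - Re ?L) * (- Re z) + Im ?L * Im z \<le> 0.05 * ((Re z)\<^sup>2 + (Im z)\<^sup>2)"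
    unfolding assms(1,2) \<sigma>_def by (simp add: algebra_simps power2_eq_square)
  show "Re z < 0" using x by simp
qed

text \<open>\<open>Im z\<close> runs from \<open>8 \<pi> / 5\<close> to \<open>2 \<pi>\<close>, so
  \<open>exp z\<close> lies in the closed lower half-plane and \<open>Im_dilog_le_0\<close> disposes
  of the imaginary part. Two terms of the series then control the real part.\<close>

lemma rate_ok_L3:
  assumes "0 \<le> \<tau>" "\<tau> \<le> 1" "- 0.2164 \<le> \<rho>" "\<rho> \<le> - 0.2162"
    and z: "Re z = - pi * (0.1 + (- 2 * \<rho> - 0.1) * \<tau>)" "Im z = pi * (1.6 + 0.4 * \<tau>)"
  shows "rate_ok z"
proof (rule rate_okI)
  let ?L = "dilog (exp z)"
  define q p r where "q = 0.1 + (- 2 * \<rho> - 0.1) * \<tau>" and "p = 1.6 + 0.4 * \<tau>" and "r = norm (exp z)"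
  have q: "0.1 + 0.3324 * \<tau> \<le> q" "q \<le> 0.1 + 0.3328 * \<tau>"
    using assms mult_right_mono[of "0.3324" "- 2 * \<rho> - 0.1" \<tau>]
      mult_right_mono[of "- 2 * \<rho> - 0.1" "0.3328" \<tau>]
    by (simp_all add: q_def)
  have q0: "q \<ge> 0.1" using q assms by simp
  have r: "r = exp (- pi * q)" by (simp add: r_def z q_def)
  have y: "Im z = pi * p" by (simp add: z p_def)
  have x: "Re z = - pi * q" by (simp add: z q_def)
  \<comment> \<open>This keeps \<open>exp z\<close> within the radius \<open>3/4\<close> of
    \<open>Im_dilog_le_0\<close>.\<close>
  have r34: "r \<le> 0.731"
  proof -
    have "1.368 \<le> exp (0.314 :: real)"
      using sum_exp_series_le[of "{..<4}" "0.314"] by (simp add: eval_nat_numeral fact_numeral)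
    also have "\<dots> \<le> exp (pi * q)"
      using mult_mono[of "3.14" pi "0.1" q] pi_approx q0 by simp
    finally show ?thesis
      unfolding r by (simp add: exp_minus divide_simps)
  qed
  have y_range: "8 * pi / 5 \<le> Im z" "Im z \<le> 2 * pi"
    using assms(1,2) by (auto simp: y p_def)
  have trig: "cos (Im z) = cos (2 * pi - Im z)" "sin (Im z) = - sin (2 * pi - Im z)"
    by (simp_all add: cos_diff sin_diff)
  have "0 \<le> sin (2 * pi - Im z)"
    by (rule sin_ge_zero) (use y_range in auto)
  then have "sin (Im z) \<le> 0" using trig(2) by linarith
  then have "Im (exp z) \<le> 0"
    by (simp add: Im_exp mult_nonneg_nonpos)
  then have Im: "Im ?L \<le> 0"
    using r34 by (intro Im_dilog_le_0) (simp_all only: r_def, simp)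
  have "r < 1" using r34 by simp
  then have lt: "norm (exp z) < 1" by (simp only: r_def)
  have err: "Re ?L \<ge> r * cos (Im z) - r\<^sup>2 / 4 - r ^ 3 / 9 / (1 - r)"
  proof -
    define E where "E = ?L - (exp z + (exp z)\<^sup>2 / 4)"
    have "norm E \<le> r ^ 3 / 9 / (1 - r)"
      using dilog_approx[OF lt, of 2] by (simp add: E_def eval_nat_numeral r_def)
    moreover have "norm ((exp z)\<^sup>2 / 4) = r\<^sup>2 / 4"
      by (simp add: norm_divide norm_power r_def)
    moreover have "Re ?L = r * cos (Im z) + Re ((exp z)\<^sup>2 / 4) + Re E"
      by (simp add: E_def Re_exp r_def)
    ultimately show ?thesis
      using abs_Re_le_cmod[of E] abs_Re_le_cmod[of "(exp z)\<^sup>2 / 4"] by linarith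
  qed
  \<comment> \<open>\<open>q\<close> and \<open>p\<close> measure \<open>z\<close> in units of
    \<open>\<pi>\<close>, and 0.157 is a lower bound for \<open>0.05 * \<pi>\<close>. For small
    \<open>\<tau>\<close> the factor \<open>q\<close> is small and a crude bound for
    \<open>Re ?L\<close> is enough; later \<open>Im z\<close> is within \<open>\<pi> / 4\<close> of
    \<open>2 \<pi>\<close>, which makes \<open>Re ?L\<close> positive.\<close>
  have main: "(pi\<^sup>2 / 6 - Re ?L) * q \<le> 0.157 * (q\<^sup>2 + p\<^sup>2)"
  proof (cases "\<tau> \<le> 0.4")
    case True
    have "r\<^sup>2 / 4 + r ^ 3 / 9 / (1 - r) \<le> 0.731\<^sup>2 / 4 + 0.731 ^ 3 / 9 / (1 - 0.731)"
      using r34 by (intro add_mono frac_le divide_right_mono power_mono) (auto simp: r_def)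
    also have "\<dots> \<le> 0.3" by (simp add: eval_nat_numeral)
    finally have "r\<^sup>2 / 4 + r ^ 3 / 9 / (1 - r) \<le> 0.3" .
    moreover have "cos (Im z) \<ge> 0"
      by (subst trig(1), rule cos_ge_zero) (use y_range in auto)
    then have "r * cos (Im z) \<ge> 0" by (simp add: r_def)
    ultimately have "Re ?L \<ge> - 0.3" using err by linarith
    then have "(pi\<^sup>2 / 6 - Re ?L) * q \<le> 1.945 * q"
      using pi_squared_le q0 by (intro mult_right_mono) auto
    also have "\<dots> \<le> 1.945 * (0.1 + 0.3328 * \<tau>)" using q by simp
    also have "\<dots> \<le> 0.157 * (2.56 + 1.28 * \<tau>)" using True by simp
    also have "\<dots> \<le> 0.157 * (q\<^sup>2 + p\<^sup>2)"
      unfolding p_def by (simp add: power2_eq_square algebra_simps add_increasing)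
    finally show ?thesis .
  next
    case False
    have "cos (Im z) \<ge> cos (pi / 4)"
      by (subst trig(1), rule cos_monotone_0_pi_le) (use y_range False in \<open>auto simp: y p_def\<close>)
    then have c: "cos (Im z) \<ge> 0.7"
      using real_le_rsqrt[of "1.4" 2] by (simp add: cos_45 power2_eq_square)
    have "pi * q \<le> 3.1416 * 0.4328"
      using pi_approx q q0 assms by (intro mult_mono) auto
    moreover have l2: "ln (2::real) \<ge> 0.6931" "ln (2::real) \<le> 0.6932"
      using ln_approx_bounds[of 2 5] by (simp_all add: eval_nat_numeral)
    moreover have "ln (4::real) = 2 * ln 2"
      using ln_realpow[of 2 2] by simp
    ultimately have "pi * q \<le> ln 4" by simp
    then have "exp (pi * q) \<le> 4"
      using exp_le_cancel_iff[of "pi * q" "ln 4"] by simp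
    then have r1: "r \<ge> 1/4"
      unfolding r by (simp add: exp_minus divide_simps)
    have "pi * q \<ge> 3.14 * 0.2329"
      using pi_approx q q0 False by (intro mult_mono) auto
    then have "pi * q \<ge> ln 2" using l2 by simp
    then have "exp (pi * q) \<ge> 2"
      using exp_le_cancel_iff[of "ln 2" "pi * q"] by simp
    then have r2: "r \<le> 1/2"
      unfolding r by (simp add: exp_minus divide_simps)
    have "r\<^sup>2 / 4 \<le> r * (1/8)"
      using mult_left_mono[OF r2, of r] r1 by (simp add: power2_eq_square)
    moreover have "r ^ 3 / 9 / (1 - r) \<le> r * (1/18)"
    proof -
      have "r * r \<le> 1/2 * (1/2)" using r1 r2 by (intro mult_mono) auto
      then have "r ^ 3 \<le> r * (1/4)"
        using mult_left_mono[of "r * r" "1/4" r] r1 by (simp add: power3_eq_cube mult.assoc)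
      then have "r ^ 3 / 9 / (1 - r) \<le> r * (1/4) / 9 / (1 - 1/2)"
        using r1 r2 by (intro frac_le divide_right_mono) auto
      then show ?thesis by simp
    qed
    moreover have "r * cos (Im z) \<ge> r * (7/10)"
      using c r1 by (intro mult_left_mono) auto
    ultimately have "Re ?L \<ge> 129/1000" using err r1 by linarith
    then have "(pi\<^sup>2 / 6 - Re ?L) * q \<le> 1.516 * q"
      using pi_squared_le q0 by (intro mult_right_mono) auto
    also have "\<dots> \<le> 0.157 * (q\<^sup>2 + p\<^sup>2)"
    proof -
      \<comment> \<open>The quadratic \<open>1.516 x - 0.157 x\<^sup>2\<close> increases in this
        range, so \<open>q\<close> may be replaced by its upper bound \<open>Q\<close>.\<close>
      define Q where "Q = 0.1 + 0.3328 * \<tau>"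
      have "0 \<le> (Q - q) * (1.516 - 0.157 * (Q + q))"
        using q assms by (intro mult_nonneg_nonneg) (auto simp: Q_def)
      then have "1.516 * q - 0.157 * q\<^sup>2 \<le> 1.516 * Q - 0.157 * Q\<^sup>2"
        by (simp add: power2_eq_square field_simps)
      also have "\<dots> \<le> 0.157 * p\<^sup>2"
      proof -
        \<comment> \<open>The margin is smallest at \<open>\<tau> = 1\<close>; this square and
          \<open>\<tau> \<le> 1\<close> yield the quadratic inequality.\<close>
        have "0 \<le> (1 - \<tau>) * (1 - \<tau>)" by simp
        then show ?thesis
          using assms(2) unfolding Q_def p_def by (simp add: power2_eq_square field_simps)
      qed
      finally show ?thesis by simp
    qed
    finally show ?thesis .
  qed
  have "(pi\<^sup>2 / 6 - Re ?L) * q * pi \<le> 0.157 * (q\<^sup>2 + p\<^sup>2) * pi"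
    using main by (intro mult_right_mono) auto
  also have "\<dots> \<le> 0.05 * pi * (q\<^sup>2 + p\<^sup>2) * pi"
    using pi_approx by (intro mult_right_mono) auto
  finally have "(pi\<^sup>2 / 6 - Re ?L) * (pi * q) \<le> 0.05 * ((pi * q)\<^sup>2 + (pi * p)\<^sup>2)"
    by (simp add: power2_eq_square algebra_simps)
  moreover have "Im ?L * Im z \<le> 0"
    using Im y_range by (intro mult_nonpos_nonneg) (auto intro: order_trans[rotated])
  ultimately show "(pi\<^sup>2 / 6 - Re ?L) * (- Re z) + Im ?L * Im z \<le> 0.05 * ((Re z)\<^sup>2 + (Im z)\<^sup>2)"
    unfolding x y by simp
  show "Re z < 0"
    unfolding x using q0 by (simp add: mult_pos_pos)
qed

section \<open>Assembling the estimate\<close>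

text \<open>A sum in place of a maximum covers both signs of the exponent.\<close>

lemma powi_le_add_powi:
  fixes v :: real
  assumes "0 < \<alpha>" "\<alpha> \<le> v" "v \<le> \<beta>"
  shows "v powi k \<le> \<alpha> powi k + \<beta> powi k"
proof (cases "k \<ge> 0")
  case True
  then have "v powi k \<le> \<beta> powi k" using assms by (intro power_int_mono) auto
  moreover have "\<alpha> powi k \<ge> 0" using assms by simp
  ultimately show ?thesis by linarith
next
  case False
  then have "v powi k \<le> \<alpha> powi k" using assms by (intro power_int_antimono) auto
  moreover have "\<beta> powi k \<ge> 0" using assms by simp
  ultimately show ?thesis by linarith
qed

text \<open>\<open>N |exp (z / N) - 1| = |z| |expm1_quot (z / N)|\<close> lies between positive
  constants on \<open>S\<close>. Hence the power of \<open>exp (z / N) - 1\<close> contributes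
  \<open>N powi (m + 1)\<close>, whatever the sign of \<open>m + 1\<close>.\<close>

lemma integrand_bound:
  assumes S: "compact S" "\<And>z. z \<in> S \<Longrightarrow> Re z \<noteq> 0 \<or> \<bar>Im z\<bar> < 2 * pi" "0 \<notin> S"
    and G: "\<And>z N. z \<in> S \<Longrightarrow> N \<ge> 1 \<Longrightarrow> norm (qpoch (exp (z / of_nat N)) N) \<ge> exp (- 0.05 * real N - G)"
  obtains C where "C \<ge> 0" "\<And>z N. z \<in> S \<Longrightarrow> N \<ge> 1 \<Longrightarrow>
    norm (integrand m N z) \<le> C * real N powi (m + 1) * exp (0.05 * real N)"
proof -
  obtain b B where b: "b > 0" and B: "B > 0"
    and bz: "\<And>z t. z \<in> S \<Longrightarrow> t \<in> {0..1} \<Longrightarrow> b \<le> norm (expm1_quot (of_real t * z))"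
    and Bz: "\<And>z t. z \<in> S \<Longrightarrow> t \<in> {0..1} \<Longrightarrow> norm (expm1_quot (of_real t * z)) \<le> B"
    using expm1_quot_bounds[OF S(1,2)] by metis
  obtain R where R: "R > 0" "\<And>z. z \<in> S \<Longrightarrow> norm z \<le> R"
    using compact_imp_bounded[OF S(1)] by (auto simp: bounded_pos)
  obtain d where d: "d > 0" "\<And>z. z \<in> S \<Longrightarrow> d \<le> norm z"
    using separate_point_closed[OF compact_imp_closed[OF S(1)] S(3)] by (auto simp: dist_norm)
  define K where "K = (d * b) powi (- (m + 1)) + (R * B) powi (- (m + 1))"
  have K: "K \<ge> 0"
    unfolding K_def using d b R B by (intro add_nonneg_nonneg) auto
  show ?thesis
  proof (rule that[of "exp R * K * exp G / (2 * pi)"])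
    show "exp R * K * exp G / (2 * pi) \<ge> 0" using K by simp
    fix z N assume z: "z \<in> S" and N: "N \<ge> (1::nat)"
    define w where "w = z / of_nat N"
    define u where "u = norm (exp w - 1)"
    have w: "w = of_real (1 / real N) * z" by (simp add: w_def)
    have t: "1 / real N \<in> {0..1}" using N by auto
    have uN: "u * real N = norm z * norm (expm1_quot w)"
      using N by (simp add: u_def exp_minus_1_eq norm_mult w_def norm_divide)
    have "d * b \<le> u * real N" "u * real N \<le> R * B"
      unfolding uN w using bz[OF z t] Bz[OF z t] d(1) d(2)[OF z] R(2)[OF z] R(1) b
      by (auto intro!: mult_mono)
    then have "(u * real N) powi (- (m + 1)) \<le> K"
      unfolding K_def using d b by (intro powi_le_add_powi) auto
    moreover have "(u * real N) powi (- (m + 1)) = inverse (u powi (m + 1)) * inverse (real N powi (m + 1))"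
      by (simp only: power_int_minus power_int_mult_distrib inverse_mult_distrib)
    ultimately have u: "inverse (u powi (m + 1)) \<le> K * real N powi (m + 1)"
      using N by (simp only: divide_inverse[symmetric] pos_divide_le_eq zero_less_power_int of_nat_0_less_iff
          less_le_trans[OF zero_less_one])
    have "norm (exp w) \<le> exp (norm w)" by (rule norm_exp)
    also have "norm w \<le> R"
    proof -
      have "R * 1 \<le> R * real N" using N R(1) by (intro mult_left_mono) auto
      then show ?thesis
        using R(2)[OF z] N by (simp add: w_def norm_divide divide_le_eq)
    qed
    finally have ew: "norm (exp w) \<le> exp R" by simp
    have q: "inverse (norm (qpoch (exp w) N)) \<le> exp (0.05 * real N) * exp G"
    proof -
      have "inverse (norm (qpoch (exp w) N)) \<le> inverse (exp (- 0.05 * real N - G))"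
        using G[OF z N] by (intro le_imp_inverse_le) (auto simp: w_def)
      then show ?thesis by (simp flip: exp_minus exp_add add: algebra_simps)
    qed
    have "norm (integrand m N z) =
        norm (exp w) * inverse (u powi (m + 1)) * inverse (norm (qpoch (exp w) N)) / (2 * pi)"
      by (simp add: integrand_def norm_divide norm_mult norm_power_int u_def w_def divide_simps)
    also have "\<dots> \<le> exp R * (K * real N powi (m + 1)) * (exp (0.05 * real N) * exp G) / (2 * pi)"
      using ew u q K by (intro divide_right_mono mult_mono) (auto simp: u_def)
    finally show "norm (integrand m N z) \<le>
        exp R * K * exp G / (2 * pi) * real N powi (m + 1) * exp (0.05 * real N)"
      by (simp add: mult_ac)
  qed
qed

definition path_bound :: "int \<Rightarrow> (nat \<Rightarrow> complex) \<Rightarrow> bool" where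
  "path_bound m f \<longleftrightarrow>
    (\<exists>C. \<forall>N::nat. N \<ge> 1 \<longrightarrow> norm (f N) \<le> C * real N powi (m + 1) * exp (0.05 * real N))"

lemma path_bound_add:
  assumes "path_bound m f" "path_bound m g"
  shows "path_bound m (\<lambda>N. f N + g N)"
proof -
  obtain C D where "\<And>N. N \<ge> 1 \<Longrightarrow> norm (f N) \<le> C * real N powi (m + 1) * exp (0.05 * real N)"
    and "\<And>N. N \<ge> 1 \<Longrightarrow> norm (g N) \<le> D * real N powi (m + 1) * exp (0.05 * real N)"
    using assms unfolding path_bound_def by metis
  then have "norm (f N + g N) \<le> (C + D) * real N powi (m + 1) * exp (0.05 * real N)" if "N \<ge> 1" for N
    using that unfolding distrib_right by (intro norm_triangle_mono)
  then show ?thesis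
    unfolding path_bound_def by blast
qed

lemma contour_integral_linepath_bound:
  assumes S: "\<And>z. z \<in> closed_segment a b \<Longrightarrow> Re z \<noteq> 0 \<or> \<bar>Im z\<bar> < 2 * pi" "0 \<notin> closed_segment a b"
    and G: "\<And>z N. z \<in> closed_segment a b \<Longrightarrow> N \<ge> 1 \<Longrightarrow>
      norm (qpoch (exp (z / of_nat N)) N) \<ge> exp (- 0.05 * real N - G)"
  shows "path_bound m (\<lambda>N. contour_integral (linepath a b) (integrand m N))"
proof -
  obtain C where C: "C \<ge> 0" "\<And>z N. z \<in> closed_segment a b \<Longrightarrow> N \<ge> 1 \<Longrightarrow>
      norm (integrand m N z) \<le> C * real N powi (m + 1) * exp (0.05 * real N)"
    using integrand_bound[OF compact_segment S G] by metis
  have "norm (contour_integral (linepath a b) (integrand m N))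
      \<le> C * norm (b - a) * real N powi (m + 1) * exp (0.05 * real N)" if "N \<ge> 1" for N
  proof (cases "integrand m N contour_integrable_on linepath a b")
    case True
    then have "norm (contour_integral (linepath a b) (integrand m N))
        \<le> (C * real N powi (m + 1) * exp (0.05 * real N)) * norm (b - a)"
      by (rule contour_integral_bound_linepath) (use C that in auto)
    then show ?thesis by (simp add: mult_ac)
  next
    \<comment> \<open>A contour integral that does not exist has the default value 0, so
      integrability need not be established.\<close>
    case False
    then show ?thesis
      using C(1) by (simp add: not_integrable_contour_integral)
  qed
  then show ?thesis unfolding path_bound_def by blast
qed

text \<open>Since \<open>rate_ok\<close> includes \<open>Re z < 0\<close>, the segment avoids 0 and
  the imaginary axis, and \<open>qpoch_exp_ge\<close> supplies one \<open>G\<close> for all its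
  points.\<close>

lemma contour_integral_linepath_bound_left:
  assumes rate: "\<And>z. z \<in> closed_segment a b \<Longrightarrow> rate_ok z"
  shows "path_bound m (\<lambda>N. contour_integral (linepath a b) (integrand m N))"
proof -
  have neg: "Re z < 0" if "z \<in> closed_segment a b" for z
    using rate[OF that] by (simp add: rate_ok_def)
  then have S: "Re z \<noteq> 0 \<or> \<bar>Im z\<bar> < 2 * pi" if "z \<in> closed_segment a b" for z
    using that by force
  obtain G where G: "\<And>z N. z \<in> closed_segment a b \<Longrightarrow> Re z < 0 \<Longrightarrow> N \<ge> 1 \<Longrightarrow>
      norm (qpoch (exp (z / of_nat N)) N)
        \<ge> exp (real N * Re ((of_real (pi\<^sup>2 / 6) - dilog (exp z)) / z) - G)"
    using qpoch_exp_ge[OF compact_segment S] by metis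
  show ?thesis
  proof (rule contour_integral_linepath_bound[OF S])
    show "0 \<notin> closed_segment a b" using neg by force
    fix z N assume z: "z \<in> closed_segment a b" and N: "N \<ge> (1::nat)"
    have "real N * (- 0.05) \<le> real N * Re ((of_real (pi\<^sup>2 / 6) - dilog (exp z)) / z)"
      using rate[OF z] by (intro mult_left_mono) (auto simp: rate_ok_def)
    then have "exp (- 0.05 * real N - G) \<le>
        exp (real N * Re ((of_real (pi\<^sup>2 / 6) - dilog (exp z)) / z) - G)"
      by (simp add: mult.commute)
    also have "\<dots> \<le> norm (qpoch (exp (z / of_nat N)) N)"
      by (rule G[OF z neg[OF z] N])
    finally show "exp (- 0.05 * real N - G) \<le> norm (qpoch (exp (z / of_nat N)) N)" .
  qed
qed

lemma closed_segment_coords: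
  assumes "z \<in> closed_segment a b"
  obtains t where "0 \<le> t" "t \<le> 1" "Re z = (1 - t) * Re a + t * Re b" "Im z = (1 - t) * Im a + t * Im b"
  using assms by (auto simp: closed_segment_def)

theorem theorem3p1:
  fixes m :: int
  shows "\<exists>C. \<forall>N::nat. N \<ge> 1 \<longrightarrow>
           norm (path_integral m N) \<le> C * real N powi (m + 1) * exp (0.05 * real N)"
proof -
  let ?I = "\<lambda>a b N. contour_integral (linepath a b) (integrand m N)"
  note cc = Re_cc_bounds
  have L1: "path_bound m (?I (2*pi) (2*pi + 8*pi*\<i>/5))"
  proof (rule contour_integral_linepath_bound)
    fix z assume "z \<in> closed_segment (complex_of_real (2*pi)) (2*pi + 8*pi*\<i>/5)"
    then have z: "Re z = 2 * pi"
      by (rule closed_segment_coords) (simp add: algebra_simps)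
    then show "Re z \<noteq> 0 \<or> \<bar>Im z\<bar> < 2 * pi" by simp
    show "norm (qpoch (exp (z / of_nat N)) N) \<ge> exp (- 0.05 * real N - 0)" if "N \<ge> 1" for N
      using qpoch_exp_ge_L1[OF z that] .
  next
    show "0 \<notin> closed_segment (complex_of_real (2*pi)) (2*pi + 8*pi*\<i>/5)"
      by (rule notI, erule closed_segment_coords) (simp add: algebra_simps)
  qed
  have L2: "path_bound m (?I (2*pi + 8*pi*\<i>/5) (-pi/10 + 8*pi*\<i>/5))"
  proof (rule contour_integral_linepath_bound)
    fix z assume "z \<in> closed_segment (2*pi + 8*pi*\<i>/5) (-pi/10 + 8*pi*\<i>/5)"
    then obtain t where t: "0 \<le> t" "t \<le> 1" "Re z = (1 - t) * (2 * pi) + t * (- pi / 10)"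
        "Im z = (1 - t) * (8 * pi / 5) + t * (8 * pi / 5)"
      by (rule closed_segment_coords) simp
    have im: "Im z = 8 * pi / 5" using t(4) by (simp add: field_simps)
    have re: "- pi / 10 \<le> Re z"
    proof -
      have "Re z = - pi / 10 + 21 / 10 * ((1 - t) * pi)" using t(3) by (simp add: field_simps)
      moreover have "0 \<le> (1 - t) * pi" using t(2) by (intro mult_nonneg_nonneg) auto
      ultimately show ?thesis by linarith
    qed
    \<comment> \<open>The segment crosses the imaginary axis, but at height
      \<open>8 \<pi> / 5 < 2 \<pi>\<close>, below the first zero of
      \<open>expm1_quot\<close>.\<close>
    show "Re z \<noteq> 0 \<or> \<bar>Im z\<bar> < 2 * pi" using im pi_gt3 by (simp add: abs_if)
    show "norm (qpoch (exp (z / of_nat N)) N) \<ge> exp (- 0.05 * real N - 10)" if "N \<ge> 1" for N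
      using qpoch_exp_ge_L2[OF re im that] .
  next
    show "0 \<notin> closed_segment (2*pi + 8*pi*\<i>/5) (-pi/10 + 8*pi*\<i>/5)"
      by (rule notI, erule closed_segment_coords) (simp add: field_simps)
  qed
  have L3: "path_bound m (?I (-pi/10 + 8*pi*\<i>/5) (2*pi*cc))"
  proof (rule contour_integral_linepath_bound_left)
    fix z assume "z \<in> closed_segment (-pi/10 + 8*pi*\<i>/5) (2*pi*cc)"
    then obtain t where t: "0 \<le> t" "t \<le> 1" "Re z = (1 - t) * (- pi / 10) + t * (2 * pi * Re cc)"
        "Im z = (1 - t) * (8 * pi / 5) + t * (2 * pi)"
      by (rule closed_segment_coords) simp
    show "rate_ok z"
      by (rule rate_ok_L3[OF t(1,2) cc]) (simp_all add: t(3,4) field_simps)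
  qed
  have L5: "path_bound m (?I (3*pi*cc) (6*pi*cc))"
  proof (rule contour_integral_linepath_bound_left)
    fix z assume "z \<in> closed_segment (3*pi*cc) (6*pi*cc)"
    then obtain t where t: "0 \<le> t" "t \<le> 1" "Re z = (1 - t) * (3 * pi * Re cc) + t * (6 * pi * Re cc)"
        "Im z = (1 - t) * (3 * pi) + t * (6 * pi)"
      by (rule closed_segment_coords) simp
    show "rate_ok z"
    proof (rule rate_ok_L5[OF _ refl _ _ cc])
      show "Re z = Re cc * Im z" by (simp add: t(3,4) algebra_simps)
      have "Im z = 3 * pi + 3 * (t * pi)" by (simp add: t(4) algebra_simps)
      moreover have "0 \<le> t * pi" using t(1) by simp
      ultimately show "3 * pi \<le> Im z" by linarith
      have "Im z = 6 * pi - 3 * ((1 - t) * pi)" by (simp add: t(4) algebra_simps)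
      moreover have "0 \<le> (1 - t) * pi" using t(2) by (intro mult_nonneg_nonneg) auto
      ultimately show "Im z \<le> 6 * pi" by linarith
    qed
  qed
  have L6: "path_bound m (?I (6*pi*cc) (-20*pi + 6*pi*\<i>))"
  proof (rule contour_integral_linepath_bound_left)
    fix z assume "z \<in> closed_segment (6*pi*cc) (-20*pi + 6*pi*\<i>)"
    then obtain t where t: "0 \<le> t" "t \<le> 1" "Re z = (1 - t) * (6 * pi * Re cc) + t * (-20 * pi)"
        "Im z = (1 - t) * (6 * pi) + t * (6 * pi)"
      by (rule closed_segment_coords) simp
    show "rate_ok z"
    proof (rule rate_ok_L6)
      show "Im z = 6 * pi" by (simp add: t(4) algebra_simps)
      \<comment> \<open>The right end of the segment has real part at most about
        \<open>- 4.075\<close>, whence the \<open>- 4\<close> in \<open>rate_ok_L6\<close>.\<close>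
      have "pi * Re cc \<le> pi * (- 0.2162)" using cc by (intro mult_left_mono) auto
      then have "6 * pi * Re cc \<le> - 4" using pi_approx by simp
      then have "(1 - t) * (6 * pi * Re cc) + t * (-20 * pi) \<le> (1 - t) * (- 4) + t * (- 4)"
        using t(1,2) pi_gt3 by (intro add_mono mult_left_mono) auto
      then show "Re z \<le> - 4" by (simp add: t(3))
    qed
  qed
  have L7: "path_bound m (?I (-20*pi + 6*pi*\<i>) (-20*pi))"
  proof (rule contour_integral_linepath_bound_left)
    fix z assume "z \<in> closed_segment (-20*pi + 6*pi*\<i>) (complex_of_real (-20*pi))"
    then obtain t where t: "0 \<le> t" "t \<le> 1" "Re z = (1 - t) * (-20 * pi) + t * (-20 * pi)"
        "Im z = (1 - t) * (6 * pi)"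
      by (rule closed_segment_coords) simp
    show "rate_ok z"
    proof (rule rate_ok_L7)
      show "Re z = - 20 * pi" by (simp add: t(3) algebra_simps)
      show "0 \<le> Im z" "Im z \<le> 6 * pi" using t(1,2) by (simp_all add: t(4))
    qed
  qed
  have "path_bound m (path_integral m)"
    unfolding path_integral_def[abs_def] by (intro path_bound_add L1 L2 L3 L5 L6 L7)
  then show ?thesis
    by (simp only: path_bound_def)
qed

end
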